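(* Let $\mathscr{U}(1)$ be the $\mathbb{Q}$-algebra obtained from $\mathscr{U}(t)$ by specializing $t=1$. Then there is an isomorphism of $\mathbb{Q}$-algebras $$\mathscr{U}(1)\simeq\mathscr{W}$$ sending $u_a$ to $[a]$ for all $a\in\mathbb{N}\cup\mathbb{N}^\vee$.
   Context: $\mathbb{N}=\{1<2<\cdots\}$, $\mathbb{N}^\vee=\{i^\vee:i\in\mathbb{N}\}$. $\mathscr{U}(t)$ is the associative unital $\mathbb{Q}[t,t^{-1}]$-algebra ($t$ an indeterminate) generated by $u_i,u_{i^\vee}$ ($i\in\mathbb{N}$) with relations: $u_iu_ju_k=u_iu_ku_j$ and $u_{k^\vee}u_{j^\vee}u_{i^\vee}=u_{j^\vee}u_{k^\vee}u_{i^\vee}$ for $j\le i<k$; $u_iu_ju_k=u_ju_iu_k$ and $u_{k^\vee}u_{j^\vee}u_{i^\vee}=u_{k^\vee}u_{i^\vee}u_{j^\vee}$ for $j<k\le i$; $u_{i+1}u_{(i+1)^\vee}=u_{i^\vee}u_i$ for $i\ge1$; $u_1u_{1^\vee}=t$; $u_iu_{j^\vee}=u_{j^\vee}u_i$ for $i\ne j$. Crystals. Let $P=\bigoplus_{i\ge1}\mathbb{Z}\epsilon_i$, $\alpha_i=\epsilon_i-\epsilon_{i+1}$, and $\langle\epsilon_j,h_i\rangle=\delta_{ij}-\delta_{i+1,j}$. A (regular) $\mathfrak{gl}_{>0}$-crystal is a set $B$ with maps $\mathrm{wt}:B\to P$, $\varepsilon_i,\varphi_i:B\to\mathbb{Z}_{\ge0}$,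 $\widetilde e_i,\widetilde f_i:B\to B\cup\{\mathbf 0\}$ ($i\ge1$), $\mathbf 0$ a formal symbol, such that $\varphi_i(b)=\langle\mathrm{wt}(b),h_i\rangle+\varepsilon_i(b)$; $\varepsilon_i(b)=\max\{k:\widetilde e_i^kb\ne\mathbf 0\}$, $\varphi_i(b)=\max\{k:\widetilde f_i^kb\neq\mathbf 0\}$; $\mathrm{wt}(\widetilde e_ib)=\mathrm{wt}(b)+\alpha_i$ if $\widetilde e_ib\ne\mathbf 0$ and $\mathrm{wt}(\widetilde f_ib)=\mathrm{wt}(b)-\alpha_i$ if $\widetilde f_ib\ne\mathbf 0$; $\widetilde f_ib=b'$ iff $b=\widetilde e_ib'$. The dual crystal is $B^\vee=\{b^\vee\}$ with $\mathrm{wt}(b^\vee)=-\mathrm{wt}(b)$, $\widetilde e_i(b^\vee)=(\widetilde f_ib)^\vee$, $\widetilde f_i(b^\vee)=(\widetilde e_ib)^\vee$. $\mathbb{N}$ is the crystal with $\mathrm{wt}(i)=\epsilon_i$, $\widetilde f_i(i)=i+1$ and $\widetilde f_i(j)=\mathbf 0$ for $j\neq i$; $\mathbb{N}^\vee$ is its dual. The tensor product $B_1\otimes B_2$ has $\mathrm{wt}(b_1\otimes b_2)=\mathrm{wt}(b_1)+\mathrm{wt}(b_2)$; $\widetilde e_i(b_1\otimes b_2)=\widetilde e_ib_1\otimes b_2$ if $\varphi_i(b_1)\ge\varepsilon_i(b_2)$ and $b_1\otimes\widetilde e_ib_2$ otherwise; $\widetilde f_i(b_1\otimes b_2)=\widetilde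 f_ib_1\otimes b_2$ if $\varphi_i(b_1)>\varepsilon_i(b_2)$ and $b_1\otimes\widetilde f_ib_2$ otherwise (with $\mathbf 0\otimes b_2=b_1\otimes\mathbf 0=\mathbf 0$). $\mathcal{W}$ is the set of finite words with letters in $\mathbb{N}\cup\mathbb{N}^\vee$, a crystal by identifying $w_1\cdots w_r$ with $w_1\otimes\cdots\otimes w_r$. For crystal elements $b_1,b_2$, $b_1\equiv b_2$ (crystal equivalence) means $\mathrm{wt}(b_1)=\mathrm{wt}(b_2)$ and $b_1,b_2$ generate the same $\mathbb{N}$-colored graph under the $\widetilde e_i,\widetilde f_i$, i.e. there is an isomorphism of colored oriented graphs between their connected components sending $b_1$ to $b_2$. $\mathscr{W}$ is the associative $\mathbb{Q}$-algebra generated by symbols $[w]$ ($w\in\mathcal{W}$) with relations $[w][w']=[ww']$ for all $w,w'$, and $[w]=[w']$ if $w\equiv w'$; its unity is $[\emptyset]$. *)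

theory Defs
  imports "HOL-Algebra.Algebra" "HOL-Library.Poly_Mapping"
begin

section \<open>Crystals\<close>

text \<open>
  The index set \<open>1 < 2 < \<dots>\<close> is the library type \<^typ>\<open>num\<close> of positive
  integers, with \<open>i + num.One\<close> the successor of \<open>i\<close>. The weight lattice is
  the free abelian group \<^typ>\<open>num \<Rightarrow>\<^sub>0 int\<close>, and the formal symbol \<open>\<zero>\<close> is
  \<^term>\<open>None\<close>. In a regular crystal the functions \<open>\<epsilon>\<^sub>i\<close> and \<open>\<phi>\<^sub>i\<close> are
  determined by the operators, hence they are not fields of the record.
\<close>

type_synonym weight = "num \<Rightarrow>\<^sub>0 int"

record 'b crystal =
  wt :: "'b \<Rightarrow> weight"
  eop :: "num \<Rightarrow> 'b \<Rightarrow> 'b option"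
  fop :: "num \<Rightarrow> 'b \<Rightarrow> 'b option"

definition iterate :: "('b \<Rightarrow> 'b option) \<Rightarrow> nat \<Rightarrow> 'b \<Rightarrow> 'b option" where
  "iterate g k b = ((\<lambda>x. Option.bind x g) ^^ k) (Some b)"

definition eps :: "'b crystal \<Rightarrow> num \<Rightarrow> 'b \<Rightarrow> nat" where
  "eps B i b = (GREATEST k. iterate (eop B i) k b \<noteq> None)"

definition phi :: "'b crystal \<Rightarrow> num \<Rightarrow> 'b \<Rightarrow> nat" where
  "phi B i b = (GREATEST k. iterate (fop B i) k b \<noteq> None)"

definition num_crystal :: "num crystal" where
  "num_crystal = \<lparr>
     wt = (\<lambda>j. Poly_Mapping.single j 1),
     eop = (\<lambda>i j. if j = i + num.One then Some i else None),
     fop = (\<lambda>i j. if j = i then Some (i + num.One) else None)\<rparr>"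

text \<open>The dual crystal is carried by the same type: \<open>b\<close> stands for \<open>b\<^sup>\<or>\<close>.\<close>

definition dual_crystal :: "'b crystal \<Rightarrow> 'b crystal" where
  "dual_crystal B = \<lparr>
     wt = (\<lambda>b. - wt B b),
     eop = fop B,
     fop = eop B\<rparr>"

definition sum_crystal :: "'a crystal \<Rightarrow> 'b crystal \<Rightarrow> ('a + 'b) crystal" where
  "sum_crystal A B = \<lparr>
     wt = case_sum (wt A) (wt B),
     eop = (\<lambda>i. case_sum (map_option Inl \<circ> eop A i) (map_option Inr \<circ> eop B i)),
     fop = (\<lambda>i. case_sum (map_option Inl \<circ> fop A i) (map_option Inr \<circ> fop B i))\<rparr>"

definition tensor_crystal :: "'a crystal \<Rightarrow> 'b crystal \<Rightarrow> ('a \<times> 'b) crystal" where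
  "tensor_crystal A B = \<lparr>
     wt = (\<lambda>(a, b). wt A a + wt B b),
     eop = (\<lambda>i (a, b).
       if phi A i a \<ge> eps B i b then map_option (\<lambda>a'. (a', b)) (eop A i a)
       else map_option (\<lambda>b'. (a, b')) (eop B i b)),
     fop = (\<lambda>i (a, b).
       if phi A i a > eps B i b then map_option (\<lambda>a'. (a', b)) (fop A i a)
       else map_option (\<lambda>b'. (a, b')) (fop B i b))\<rparr>"

text \<open>
  \<open>tensor_power B n\<close> is \<open>B \<otimes> (B \<otimes> \<dots>)\<close> with \<open>n\<close> factors, an element being
  written as a list of length \<open>n\<close>; only lists of that length are relevant.
  The words of length \<open>0\<close> form the trivial crystal.
\<close>

primrec tensor_power :: "'b crystal \<Rightarrow> nat \<Rightarrow> 'b list crystal" where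
  "tensor_power B 0 = \<lparr>wt = (\<lambda>_. 0), eop = (\<lambda>_ _. None), fop = (\<lambda>_ _. None)\<rparr>"
| "tensor_power B (Suc n) =
    (let T = tensor_crystal B (tensor_power B n) in \<lparr>
       wt = (\<lambda>w. wt T (hd w, tl w)),
       eop = (\<lambda>i w. map_option (\<lambda>(a, v). a # v) (eop T i (hd w, tl w))),
       fop = (\<lambda>i w. map_option (\<lambda>(a, v). a # v) (fop T i (hd w, tl w)))\<rparr>)"

definition words_crystal :: "'b crystal \<Rightarrow> 'b list crystal" where
  "words_crystal B = \<lparr>
     wt = (\<lambda>w. wt (tensor_power B (length w)) w),
     eop = (\<lambda>i w. eop (tensor_power B (length w)) i w),
     fop = (\<lambda>i w. fop (tensor_power B (length w)) i w)\<rparr>"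

definition component :: "'b crystal \<Rightarrow> 'b \<Rightarrow> 'b set" where
  "component B b =
     {(x, y). \<exists>i. eop B i x = Some y \<or> fop B i x = Some y}\<^sup>* `` {b}"

text \<open>The arrows of colour \<open>i\<close> of the crystal graph go from \<open>x\<close> to \<open>f\<^sub>i x\<close>.\<close>

definition crystal_equiv :: "'a crystal \<Rightarrow> 'b crystal \<Rightarrow> 'a \<Rightarrow> 'b \<Rightarrow> bool" where
  "crystal_equiv A B a b \<longleftrightarrow>
     wt A a = wt B b \<and>
     (\<exists>h. bij_betw h (component A a) (component B b) \<and> h a = b \<and>
       (\<forall>i. \<forall>x\<in>component A a. \<forall>y\<in>component A a.
          fop A i x = Some y \<longleftrightarrow> fop B i (h x) = Some (h y)))"

text \<open>The letter \<open>i\<close> is \<^term>\<open>Inl i\<close>, and \<open>i\<^sup>\<or>\<close> is \<^term>\<open>Inr i\<close>.\<close>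

type_synonym letter = "num + num"

definition letter_crystal :: "letter crystal" where
  "letter_crystal = sum_crystal num_crystal (dual_crystal num_crystal)"

definition word_crystal :: "letter list crystal" where
  "word_crystal = words_crystal letter_crystal"

abbreviation word_equiv :: "letter list \<Rightarrow> letter list \<Rightarrow> bool" where
  "word_equiv v w \<equiv> crystal_equiv word_crystal word_crystal v w"


section \<open>Algebras given by generators and relations\<close>

text \<open>
  Algebras over a commutative ring are records of type \<open>module\<close>: a (not
  necessarily commutative) ring together with a scalar multiplication. The
  scalars form a type of class \<open>comm_ring_1\<close>.

  The free monoid is written additively, so that the convolution product of
  \<^theory>\<open>HOL-Library.Poly_Mapping\<close> is the product of its monoid algebra.
\<close>

datatype 'g free_monoid = Mon (mon_list: "'g list")

instantiation free_monoid :: (type) monoid_add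
begin

definition zero_free_monoid :: "'a free_monoid" where
  "zero_free_monoid = Mon []"

definition plus_free_monoid :: "'a free_monoid \<Rightarrow> 'a free_monoid \<Rightarrow> 'a free_monoid" where
  "plus_free_monoid x y = Mon (mon_list x @ mon_list y)"

instance
  by standard (simp_all add: zero_free_monoid_def plus_free_monoid_def)

end

type_synonym ('k, 'g) free_alg = "'g free_monoid \<Rightarrow>\<^sub>0 'k"

definition scalar :: "'k \<Rightarrow> ('k::comm_ring_1, 'g) free_alg" where
  "scalar c = Poly_Mapping.single 0 c"

definition gen :: "'g \<Rightarrow> ('k::comm_ring_1, 'g) free_alg" where
  "gen g = Poly_Mapping.single (Mon [g]) 1"

definition free_algebra :: "('k::comm_ring_1, ('k, 'g) free_alg) module" where
  "free_algebra = \<lparr>carrier = UNIV, monoid.mult = (*), one = 1, ring.zero = 0, add = (+),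
     smult = (\<lambda>c p. scalar c * p)\<rparr>"

definition quotient_algebra :: "('k, 'a, 'm) module_scheme \<Rightarrow> 'a set \<Rightarrow> ('k, 'a set) module" where
  "quotient_algebra A I =
     ring.extend (A Quot I) (module.fields (\<lambda>c C. \<Union>x\<in>C. I +>\<^bsub>A\<^esub> (c \<odot>\<^bsub>A\<^esub> x)))"

text \<open>
  \<^const>\<open>genideal\<close> is the two-sided ideal generated by a set; a pair in \<open>R\<close>
  stands for the relation equating its two components.
\<close>

definition relation_ideal ::
    "(('k::comm_ring_1, 'g) free_alg \<times> ('k, 'g) free_alg) set \<Rightarrow> ('k, 'g) free_alg set" where
  "relation_ideal R = Idl\<^bsub>free_algebra\<^esub> {p - q | p q. (p, q) \<in> R}"

definition presented_algebra ::
    "(('k::comm_ring_1, 'g) free_alg \<times> ('k, 'g) free_alg) set \<Rightarrow>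
     ('k, ('k, 'g) free_alg set) module" where
  "presented_algebra R = quotient_algebra free_algebra (relation_ideal R)"

definition presented_gen ::
    "(('k::comm_ring_1, 'g) free_alg \<times> ('k, 'g) free_alg) set \<Rightarrow> 'g \<Rightarrow>
     ('k, 'g) free_alg set" where
  "presented_gen R g = relation_ideal R +>\<^bsub>free_algebra\<^esub> gen g"

definition restrict_scalars ::
    "('k \<Rightarrow> 'l) \<Rightarrow> ('l, 'a, 'm) module_scheme \<Rightarrow> ('k, 'a) module" where
  "restrict_scalars h A =
     ring.extend (ring.truncate A) (module.fields (\<lambda>c x. h c \<odot>\<^bsub>A\<^esub> x))"

definition algebra_iso ::
    "('k, 'a, 'm) module_scheme \<Rightarrow> ('k, 'b, 'n) module_scheme \<Rightarrow> ('a \<Rightarrow> 'b) set" where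
  "algebra_iso A B =
     {h \<in> ring_iso A B. \<forall>c. \<forall>x\<in>carrier A. h (c \<odot>\<^bsub>A\<^esub> x) = c \<odot>\<^bsub>B\<^esub> h x}"

lemma ring_free_algebra: "ring (free_algebra :: ('k::comm_ring_1, ('k, 'g) free_alg) module)"
proof -
  have "\<exists>y. y + x = 0 \<and> x + y = 0" for x :: "('k, 'g) free_alg"
    by (rule exI[of _ "- x"]) simp
  then show ?thesis
    by unfold_locales (auto simp: free_algebra_def Units_def algebra_simps)
qed


section \<open>The algebra \<open>\<U>(t)\<close> and its specialization at \<open>t = 1\<close>\<close>

text \<open>\<open>\<rat>[t, t\<^sup>-\<^sup>1]\<close> is the monoid algebra of the additive group of integers.\<close>

type_synonym laurent = "int \<Rightarrow>\<^sub>0 rat"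

definition tvar :: laurent where
  "tvar = Poly_Mapping.single 1 1"

definition laurent_const :: "rat \<Rightarrow> laurent" where
  "laurent_const c = Poly_Mapping.single 0 c"

abbreviation u :: "num \<Rightarrow> (laurent, letter) free_alg" where
  "u i \<equiv> gen (Inl i)"

abbreviation ud :: "num \<Rightarrow> (laurent, letter) free_alg" where
  "ud i \<equiv> gen (Inr i)"

inductive_set U_rel :: "((laurent, letter) free_alg \<times> (laurent, letter) free_alg) set" where
  "\<lbrakk>j \<le> i; i < k\<rbrakk> \<Longrightarrow> (u i * u j * u k, u i * u k * u j) \<in> U_rel"
| "\<lbrakk>j \<le> i; i < k\<rbrakk> \<Longrightarrow> (ud k * ud j * ud i, ud j * ud k * ud i) \<in> U_rel"
| "\<lbrakk>j < k; k \<le> i\<rbrakk> \<Longrightarrow> (u i * u j * u k, u j * u i * u k) \<in> U_rel"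
| "\<lbrakk>j < k; k \<le> i\<rbrakk> \<Longrightarrow> (ud k * ud j * ud i, ud k * ud i * ud j) \<in> U_rel"
| "(u (i + num.One) * ud (i + num.One), ud i * u i) \<in> U_rel"
| "(u num.One * ud num.One, scalar tvar) \<in> U_rel"
| "i \<noteq> j \<Longrightarrow> (u i * ud j, ud j * u i) \<in> U_rel"

definition U_t :: "(laurent, (laurent, letter) free_alg set) module" where
  "U_t = presented_algebra U_rel"

text \<open>
  The specialization is \<open>\<U>(t) \<otimes> \<rat>[t, t\<^sup>-\<^sup>1]/(t - 1) = \<U>(t)/(t - 1)\<U>(t)\<close>, viewed
  as an algebra over the rationals.
\<close>

definition t_minus_1_ideal :: "(laurent, letter) free_alg set set" where
  "t_minus_1_ideal = Idl\<^bsub>U_t\<^esub> {(tvar - 1) \<odot>\<^bsub>U_t\<^esub> \<one>\<^bsub>U_t\<^esub>}"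

definition U_1 :: "(rat, (laurent, letter) free_alg set set) module" where
  "U_1 = restrict_scalars laurent_const (quotient_algebra U_t t_minus_1_ideal)"

definition U_1_gen :: "letter \<Rightarrow> (laurent, letter) free_alg set set" where
  "U_1_gen a = t_minus_1_ideal +>\<^bsub>U_t\<^esub> presented_gen U_rel a"


section \<open>The algebra of words modulo crystal equivalence\<close>

text \<open>Every word is a generator, so monomials of the free algebra are lists of words.\<close>

inductive_set W_rel :: "((rat, letter list) free_alg \<times> (rat, letter list) free_alg) set" where
  "(gen v * gen w, gen (v @ w)) \<in> W_rel"
| "word_equiv v w \<Longrightarrow> (gen v, gen w) \<in> W_rel"
| "(gen [], 1) \<in> W_rel"

definition W_alg :: "(rat, (rat, letter list) free_alg set) module" where
  "W_alg = presented_algebra W_rel"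

definition W_sym :: "letter list \<Rightarrow> (rat, letter list) free_alg set" where
  "W_sym w = presented_gen W_rel w"

end

theory Submission
  imports Defs
begin

text \<open>
  Both algebras are monoid algebras. The relations of \<open>\<W>\<close> identify a product of words
  with their concatenation, so \<open>\<W>\<close> is spanned by words modulo the congruence
  generated by crystal equivalence. Once \<open>t\<close> is \<open>1\<close>, the relations of \<open>\<U>(t)\<close>
  equate monomials, so \<open>\<U>(1)\<close> is spanned by words modulo a congruence \<open>\<sim>\<close> generated
  by finitely many types of moves. The theorem therefore says that the two sides of a
  move are crystal equivalent, and that crystal equivalent words are congruent.

  The first part is a computation. The moves, suitably oriented, form a partial bijection
  between short words that commutes with all crystal operators, hence induce isomorphisms
  of components (\<open>word_equiv_basic_move\<close>). The same computation shows that \<open>\<sim>\<close> is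
  compatible with the operators on words of any length (\<open>word_cong_e\<close>, \<open>word_cong_f\<close>).

  For the second part (\<open>word_cong_if_word_equiv\<close>), the moves bring each word to the form
  \<open>v\<^sup>\<or> w\<close> with the dual letters on the left. A component need not have a highest weight
  element, because \<open>i\<^sup>\<or>\<close> is raised to \<open>(i + 1)\<^sup>\<or>\<close> without end, and for the same reason
  \<open>v\<^sup>\<or>\<close> can be moved away from \<open>w\<close>. Suppose that all letters are at most \<open>n\<close>, and
  apply \<open>e\<^sub>i\<close> for \<open>i < N\<close> as long as possible, where \<open>N\<close> is at least \<open>n\<close> plus the
  length of \<open>v\<close>. The result is again of the form \<open>v\<^sup>\<or> w\<close>; now all letters of \<open>v\<close> are larger
  than \<open>n\<close> and those of \<open>w\<close> are not, and \<open>v\<close> and \<open>w\<close> are Yamanouchi words for suitable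
  orders of the letters. The same operators take an equivalent word to a word with the
  same properties and the same weight. As nothing cancels in the weight, the contents of
  the Yamanouchi words agree, and two Yamanouchi words of equal content are congruent
  (\<open>yamanouchi_cong\<close>). Lowering operators carry the congruence back to the given words.
\<close>

section \<open>Crystal operators on words\<close>

abbreviation letter_e :: "num \<Rightarrow> letter \<Rightarrow> letter option" where
  "letter_e \<equiv> eop letter_crystal"

abbreviation letter_f :: "num \<Rightarrow> letter \<Rightarrow> letter option" where
  "letter_f \<equiv> fop letter_crystal"

lemma letter_e_simps [simp]:
  "letter_e i (Inl j) = (if j = i + num.One then Some (Inl i) else None)"
  "letter_e i (Inr j) = (if j = i then Some (Inr (i + num.One)) else None)"
  by (auto simp: letter_crystal_def sum_crystal_def num_crystal_def dual_crystal_def)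

lemma letter_f_simps [simp]:
  "letter_f i (Inl j) = (if j = i then Some (Inl (i + num.One)) else None)"
  "letter_f i (Inr j) = (if j = i + num.One then Some (Inr i) else None)"
  by (auto simp: letter_crystal_def sum_crystal_def num_crystal_def dual_crystal_def)

lemma letter_wt_simps [simp]:
  "wt letter_crystal (Inl j) = Poly_Mapping.single j 1"
  "wt letter_crystal (Inr j) = - Poly_Mapping.single j 1"
  by (auto simp: letter_crystal_def sum_crystal_def num_crystal_def dual_crystal_def)

text \<open>
  The order and the successor function of the index type are transported to
  natural numbers, where linear arithmetic decides the side conditions that the
  case distinctions on letters produce.
\<close>
lemma nat_of_num_neq_zero: "nat_of_num i \<noteq> 0"
  using nat_of_num_pos[of i] by simp

lemmas num_to_nat = num_eq_iff less_num_def less_eq_num_def nat_of_num_add nat_of_num_neq_zero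

lemma num_succ_neq [simp]: "i \<noteq> i + num.One" "i + num.One \<noteq> i"
  by (auto simp: num_to_nat)

definition letter_eps :: "num \<Rightarrow> letter \<Rightarrow> nat" where
  "letter_eps i a = (if letter_e i a = None then 0 else 1)"

definition letter_phi :: "num \<Rightarrow> letter \<Rightarrow> nat" where
  "letter_phi i a = (if letter_f i a = None then 0 else 1)"

lemma letter_e_Some:
  assumes "letter_e i a = Some b"
  shows "letter_f i b = Some a" "letter_eps i a = Suc (letter_eps i b)"
    "letter_phi i b = Suc (letter_phi i a)"
  using assms by (cases a; auto simp: letter_eps_def letter_phi_def split: if_splits)+

lemma letter_f_Some:
  assumes "letter_f i a = Some b"
  shows "letter_e i b = Some a" "letter_phi i a = Suc (letter_phi i b)"
    "letter_eps i b = Suc (letter_eps i a)"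
  using assms by (cases a; auto simp: letter_eps_def letter_phi_def split: if_splits)+

lemma letter_e_None: "letter_e i a = None \<longleftrightarrow> letter_eps i a = 0"
  by (simp add: letter_eps_def)

lemma letter_f_None: "letter_f i a = None \<longleftrightarrow> letter_phi i a = 0"
  by (simp add: letter_phi_def)

lemma iterate_Suc: "iterate g (Suc k) b = Option.bind (g b) (iterate g k)"
proof -
  have "((\<lambda>x. Option.bind x g) ^^ k) None = None" for k
    by (induction k) auto
  then show ?thesis
    by (cases "g b") (auto simp: iterate_def funpow_Suc_right simp del: funpow.simps)
qed

text \<open>
  A number that vanishes exactly where \<open>g\<close> is undefined, and drops by one along
  \<open>g\<close>, counts how often \<open>g\<close> applies. This is how the maxima in \<^const>\<open>eps\<close> and
  \<^const>\<open>phi\<close> are computed.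
\<close>
lemma Greatest_iterate:
  assumes "\<And>x. x \<in> S \<Longrightarrow> g x = None \<longleftrightarrow> E x = 0"
    and "\<And>x y. x \<in> S \<Longrightarrow> g x = Some y \<Longrightarrow> y \<in> S \<and> E x = Suc (E y)"
    and "b \<in> S"
  shows "(GREATEST k. iterate g k b \<noteq> None) = E b"
proof -
  have "iterate g k b \<noteq> None \<longleftrightarrow> k \<le> E b" for k
    using \<open>b \<in> S\<close>
  proof (induction k arbitrary: b)
    case 0
    then show ?case by (simp add: iterate_def)
  next
    case (Suc k)
    show ?case
    proof (cases "g b")
      case None
      with assms(1)[OF Suc.prems] show ?thesis by (simp add: iterate_Suc)
    next
      case (Some c)
      then show ?thesis using assms(2) Suc by (simp add: iterate_Suc)
    qed
  qed
  then show ?thesis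
    by (auto intro!: Greatest_equality)
qed

text \<open>
  The tensor product rule, unrolled along a word: in \<open>v \<otimes> w\<close> the number \<open>\<phi>\<^sub>i(v)\<close>
  cancels against \<open>\<epsilon>\<^sub>i(w)\<close>, and an operator acts on the factor that contributes to
  what is left. These recursions avoid maxima over iterates; that they describe the
  crystal of words is shown in \<open>tensor_power_letter\<close>.
\<close>
primrec word_eps :: "num \<Rightarrow> letter list \<Rightarrow> nat" where
  "word_eps i [] = 0"
| "word_eps i (a # w) = letter_eps i a + (word_eps i w - letter_phi i a)"

primrec word_phi :: "num \<Rightarrow> letter list \<Rightarrow> nat" where
  "word_phi i [] = 0"
| "word_phi i (a # w) = word_phi i w + (letter_phi i a - word_eps i w)"

primrec word_e :: "num \<Rightarrow> letter list \<Rightarrow> letter list option" where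
  "word_e i [] = None"
| "word_e i (a # w) =
    (if word_eps i w \<le> letter_phi i a then map_option (\<lambda>b. b # w) (letter_e i a)
     else map_option ((#) a) (word_e i w))"

primrec word_f :: "num \<Rightarrow> letter list \<Rightarrow> letter list option" where
  "word_f i [] = None"
| "word_f i (a # w) =
    (if word_eps i w < letter_phi i a then map_option (\<lambda>b. b # w) (letter_f i a)
     else map_option ((#) a) (word_f i w))"

primrec word_wt :: "letter list \<Rightarrow> weight" where
  "word_wt [] = 0"
| "word_wt (a # w) = wt letter_crystal a + word_wt w"

lemma word_e_None: "word_e i w = None \<longleftrightarrow> word_eps i w = 0"
  by (induction w) (auto simp: letter_e_None)

lemma word_f_None: "word_f i w = None \<longleftrightarrow> word_phi i w = 0"
  by (induction w) (auto simp: letter_f_None)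

lemma word_e_Some:
  assumes "word_e i w = Some w'"
  shows "word_f i w' = Some w \<and> word_eps i w = Suc (word_eps i w') \<and>
    word_phi i w' = Suc (word_phi i w) \<and> length w' = length w"
  using assms
proof (induction w arbitrary: w')
  case (Cons a w)
  show ?case
  proof (cases "word_eps i w \<le> letter_phi i a")
    case True
    with Cons.prems obtain b where "letter_e i a = Some b" "w' = b # w" by auto
    with True letter_e_Some[OF this(1)] show ?thesis by auto
  next
    case False
    with Cons.prems obtain v where "word_e i w = Some v" "w' = a # v" by auto
    with False Cons.IH[OF this(1)] show ?thesis by auto
  qed
qed simp

lemma word_f_Some:
  assumes "word_f i w = Some w'"
  shows "word_e i w' = Some w \<and> word_phi i w = Suc (word_phi i w') \<and>
    word_eps i w' = Suc (word_eps i w) \<and> length w' = length w"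
  using assms
proof (induction w arbitrary: w')
  case (Cons a w)
  show ?case
  proof (cases "word_eps i w < letter_phi i a")
    case True
    with Cons.prems obtain b where "letter_f i a = Some b" "w' = b # w" by auto
    with True letter_f_Some[OF this(1)] show ?thesis by auto
  next
    case False
    with Cons.prems obtain v where "word_f i w = Some v" "w' = a # v" by auto
    with False Cons.IH[OF this(1)] show ?thesis by auto
  qed
qed simp

lemma word_f_iff_e: "word_f i v = Some w \<longleftrightarrow> word_e i w = Some v"
  using word_e_Some word_f_Some by blast

lemma eps_letter: "eps letter_crystal i a = letter_eps i a"
  unfolding eps_def
  by (rule Greatest_iterate[where S = UNIV]) (auto simp: letter_e_None dest: letter_e_Some)

lemma phi_letter: "phi letter_crystal i a = letter_phi i a"
  unfolding phi_def
  by (rule Greatest_iterate[where S = UNIV]) (auto simp: letter_f_None dest: letter_f_Some)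

text \<open>
  The recursion for the operators on words of length \<open>n + 1\<close> asks for \<^const>\<open>eps\<close>
  on words of length \<open>n\<close>; this value is \<^const>\<open>word_eps\<close>, because by induction the
  operator itself is already known to be \<^const>\<open>word_e\<close>.
\<close>
lemma tensor_power_letter:
  assumes "length w = n"
  shows "wt (tensor_power letter_crystal n) w = word_wt w"
    and "eop (tensor_power letter_crystal n) i w = word_e i w"
    and "fop (tensor_power letter_crystal n) i w = word_f i w"
proof -
  have "\<forall>w. length w = n \<longrightarrow> wt (tensor_power letter_crystal n) w = word_wt w \<and>
     eop (tensor_power letter_crystal n) i w = word_e i w \<and>
     fop (tensor_power letter_crystal n) i w = word_f i w"
  proof (induction n)
    case (Suc n)
    let ?T = "tensor_power letter_crystal n"
    have eps: "eps ?T i v = word_eps i v" if "length v = n" for v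
      unfolding eps_def
      by (rule Greatest_iterate[where S = "{v. length v = n}"])
        (use that Suc.IH word_e_Some in \<open>auto simp: word_e_None\<close>)
    show ?case
    proof (intro allI impI)
      fix w :: "letter list"
      assume "length w = Suc n"
      then obtain a v where "w = a # v" "length v = n" by (auto simp: length_Suc_conv)
      with Suc.IH eps[of v] show "wt (tensor_power letter_crystal (Suc n)) w = word_wt w \<and>
          eop (tensor_power letter_crystal (Suc n)) i w = word_e i w \<and>
          fop (tensor_power letter_crystal (Suc n)) i w = word_f i w"
        by (simp add: tensor_crystal_def Let_def phi_letter option.map_comp comp_def)
    qed
  qed auto
  with assms show "wt (tensor_power letter_crystal n) w = word_wt w"
    "eop (tensor_power letter_crystal n) i w = word_e i w"
    "fop (tensor_power letter_crystal n) i w = word_f i w" by auto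
qed

lemma word_crystal_simps [simp]:
  "wt word_crystal = word_wt" "eop word_crystal = word_e" "fop word_crystal = word_f"
  by (auto simp: word_crystal_def words_crystal_def tensor_power_letter fun_eq_iff)

text \<open>
  The tensor product is associative: the rule for a letter in front of a word
  holds for any decomposition of a word into two factors.
\<close>
lemma word_eps_phi_append:
  "word_eps i (v @ w) = word_eps i v + (word_eps i w - word_phi i v)"
  "word_phi i (v @ w) = word_phi i w + (word_phi i v - word_eps i w)"
  by (induction v) auto

lemma map_option_append_Nil [simp]: "map_option ((@) []) x = x"
  by (cases x) auto

lemma word_e_append:
  "word_e i (v @ w) =
    (if word_eps i w \<le> word_phi i v then map_option (\<lambda>x. x @ w) (word_e i v)
     else map_option ((@) v) (word_e i w))"
  by (induction v)
    (auto simp: word_eps_phi_append option.map_comp comp_def word_e_None letter_e_None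
      option.map_ident
      intro!: option.map_cong)

lemma word_f_append:
  "word_f i (v @ w) =
    (if word_eps i w < word_phi i v then map_option (\<lambda>x. x @ w) (word_f i v)
     else map_option ((@) v) (word_f i w))"
  by (induction v)
    (auto simp: word_eps_phi_append option.map_comp comp_def word_f_None letter_f_None
      option.map_ident fun_eq_iff
      intro!: option.map_cong)

lemma word_wt_append [simp]: "word_wt (v @ w) = word_wt v + word_wt w"
  by (induction v) (auto simp: add.assoc)

definition simple_root :: "num \<Rightarrow> weight" where
  "simple_root i = Poly_Mapping.single i 1 - Poly_Mapping.single (i + num.One) 1"

lemma word_wt_e: "word_e i w = Some w' \<Longrightarrow> word_wt w' = word_wt w + simple_root i"
proof (induction w arbitrary: w')
  case (Cons a w)
  then show ?case
    by (cases a) (auto split: if_splits simp: simple_root_def)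
qed simp

section \<open>Moves and crystal equivalence\<close>

text \<open>
  The defining relations of \<open>\<U>(1)\<close> as replacements of words. The orientation is
  chosen so that the moves form the graph of a partial bijection that commutes with
  the crystal operators. The first and third family (and likewise the two dual ones)
  have to be taken together, with compatible orientations, since an operator may lead
  from one to the other: \<open>f\<^sub>1\<close> takes the move from \<open>112\<close> to \<open>121\<close> to the move from
  \<open>212\<close> to \<open>122\<close>.
\<close>
inductive basic_move :: "letter list \<Rightarrow> letter list \<Rightarrow> bool" where
  "\<lbrakk>j \<le> i; i < k\<rbrakk> \<Longrightarrow> basic_move [Inl i, Inl j, Inl k] [Inl i, Inl k, Inl j]"
| "\<lbrakk>j \<le> i; i < k\<rbrakk> \<Longrightarrow> basic_move [Inr k, Inr j, Inr i] [Inr j, Inr k, Inr i]"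
| "\<lbrakk>j < k; k \<le> i\<rbrakk> \<Longrightarrow> basic_move [Inl i, Inl j, Inl k] [Inl j, Inl i, Inl k]"
| "\<lbrakk>j < k; k \<le> i\<rbrakk> \<Longrightarrow> basic_move [Inr k, Inr j, Inr i] [Inr k, Inr i, Inr j]"
| "basic_move [Inl (i + num.One), Inr (i + num.One)] [Inr i, Inl i]"
| "basic_move [Inl num.One, Inr num.One] []"
| "i \<noteq> j \<Longrightarrow> basic_move [Inl i, Inr j] [Inr j, Inl i]"

lemma basic_move_left_unique: "basic_move v w \<Longrightarrow> basic_move v' w \<Longrightarrow> v = v'"
  by (auto elim!: basic_move.cases simp: num_to_nat)

lemma basic_move_right_unique: "basic_move v w \<Longrightarrow> basic_move v w' \<Longrightarrow> w = w'"
  by (auto elim!: basic_move.cases simp: num_to_nat)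

lemma basic_move_wt: "basic_move v w \<Longrightarrow> word_wt v = word_wt w"
  by (induction rule: basic_move.induct) (auto simp: algebra_simps)

lemma basic_move_eps: "basic_move v w \<Longrightarrow> word_eps i v = word_eps i w"
  by (induction rule: basic_move.induct)
    (auto simp: letter_eps_def letter_phi_def num_to_nat)

lemma basic_move_phi: "basic_move v w \<Longrightarrow> word_phi i v = word_phi i w"
  by (induction rule: basic_move.induct)
    (auto simp: letter_eps_def letter_phi_def split: if_splits; simp add: num_to_nat)+

lemma basic_move_e: "basic_move v w \<Longrightarrow> rel_option basic_move (word_e i v) (word_e i w)"
  by (induction rule: basic_move.induct)
    (auto simp: letter_eps_def letter_phi_def split: if_splits intro!: basic_move.intros;
     simp add: num_to_nat)+

lemma basic_move_f: "basic_move v w \<Longrightarrow> rel_option basic_move (word_f i v) (word_f i w)"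
  by (induction rule: basic_move.induct)
    (auto simp: letter_eps_def letter_phi_def split: if_splits intro!: basic_move.intros;
     simp add: num_to_nat)+

definition crystal_edges :: "'b crystal \<Rightarrow> ('b \<times> 'b) set" where
  "crystal_edges B = {(x, y). \<exists>i. eop B i x = Some y \<or> fop B i x = Some y}"

lemma component_edges: "component B b = (crystal_edges B)\<^sup>* `` {b}"
  by (simp add: component_def crystal_edges_def)

text \<open>
  A bisimulation alone might fold a component onto a smaller one. If it is
  single-valued in both directions, it restricts to the graph of a bijection of the
  two components, which is then an isomorphism of coloured graphs.
\<close>
lemma crystal_equiv_of_bisimulation:
  assumes "R a b"
    and weight: "\<And>x y. R x y \<Longrightarrow> wt A x = wt B y"
    and e: "\<And>i x y. R x y \<Longrightarrow> rel_option R (eop A i x) (eop B i y)"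
    and f: "\<And>i x y. R x y \<Longrightarrow> rel_option R (fop A i x) (fop B i y)"
    and left: "\<And>x x' y. R x y \<Longrightarrow> R x' y \<Longrightarrow> x = x'"
    and right: "\<And>x y y'. R x y \<Longrightarrow> R x y' \<Longrightarrow> y = y'"
  shows "crystal_equiv A B a b"
proof -
  have fwd: "\<exists>y \<in> component B b. R x y" if "x \<in> component A a" for x
  proof -
    have "(a, x) \<in> (crystal_edges A)\<^sup>*" using that by (simp add: component_edges)
    then show ?thesis
    proof (induction rule: rtrancl_induct)
      case base
      then show ?case using \<open>R a b\<close> by (auto simp: component_edges)
    next
      case (step x z)
      then obtain y where y: "y \<in> component B b" "R x y" by blast
      from step(2) obtain i where "eop A i x = Some z \<or> fop A i x = Some z"
        by (auto simp: crystal_edges_def)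
      with e[OF y(2), of i] f[OF y(2), of i]
      obtain y' where "eop B i y = Some y' \<or> fop B i y = Some y'" and R: "R z y'"
        by (metis option_rel_Some1)
      then have "(y, y') \<in> crystal_edges B" by (auto simp: crystal_edges_def)
      with y(1) R show ?case by (auto simp: component_edges intro: rtrancl_into_rtrancl)
    qed
  qed
  have bwd: "\<exists>x \<in> component A a. R x y" if "y \<in> component B b" for y
  proof -
    have "(b, y) \<in> (crystal_edges B)\<^sup>*" using that by (simp add: component_edges)
    then show ?thesis
    proof (induction rule: rtrancl_induct)
      case base
      then show ?case using \<open>R a b\<close> by (auto simp: component_edges)
    next
      case (step y z)
      then obtain x where x: "x \<in> component A a" "R x y" by blast
      from step(2) obtain i where "eop B i y = Some z \<or> fop B i y = Some z"
        by (auto simp: crystal_edges_def)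
      with e[OF x(2), of i] f[OF x(2), of i]
      obtain x' where "eop A i x = Some x' \<or> fop A i x = Some x'" and R: "R x' z"
        by (metis option_rel_Some2)
      then have "(x, x') \<in> crystal_edges A" by (auto simp: crystal_edges_def)
      with x(1) R show ?case by (auto simp: component_edges intro: rtrancl_into_rtrancl)
    qed
  qed
  define h where "h x = (THE y. R x y)" for x
  have h: "h x = y" if "R x y" for x y
    unfolding h_def using that right by blast
  have hR: "R x (h x)" if "x \<in> component A a" for x
    using fwd[OF that] h by blast
  have "bij_betw h (component A a) (component B b)"
    unfolding bij_betw_def
  proof
    show "inj_on h (component A a)"
      by (rule inj_onI) (metis hR left)
    show "h ` component A a = component B b"
      using fwd bwd h by (auto simp: image_iff) blast+
  qed
  moreover have "fop A i x = Some y \<longleftrightarrow> fop B i (h x) = Some (h y)"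
    if "x \<in> component A a" "y \<in> component A a" for i x y
  proof
    assume "fop A i x = Some y"
    with f[OF hR[OF that(1)], of i] show "fop B i (h x) = Some (h y)"
      using h by (auto simp: option_rel_Some1)
  next
    assume "fop B i (h x) = Some (h y)"
    with f[OF hR[OF that(1)], of i] obtain z where "fop A i x = Some z" "R z (h y)"
      by (auto simp: option_rel_Some2)
    with left[OF this(2) hR[OF that(2)]] show "fop A i x = Some y" by simp
  qed
  ultimately show ?thesis
    unfolding crystal_equiv_def using weight[OF \<open>R a b\<close>] h[OF \<open>R a b\<close>] by blast
qed

lemma word_equiv_basic_move: "basic_move v w \<Longrightarrow> word_equiv v w"
proof (rule crystal_equiv_of_bisimulation[where R = basic_move])
  show "x = x'" if "basic_move x y" "basic_move x' y" for x x' y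
    using that by (rule basic_move_left_unique)
  show "y = y'" if "basic_move x y" "basic_move x y'" for x y y'
    using that by (rule basic_move_right_unique)
qed (simp_all add: basic_move_e basic_move_f basic_move_wt)

text \<open>
  An isomorphism between components commutes with the operators. The weight has to
  be treated separately, as the isomorphism need not preserve it away from the
  base point a priori; it does, because both weights change by the same root.
\<close>
lemma word_equiv_e:
  assumes "word_equiv v w"
  shows "rel_option word_equiv (word_e i v) (word_e i w)"
proof -
  from assms obtain h where wt: "word_wt v = word_wt w"
    and bij: "bij_betw h (component word_crystal v) (component word_crystal w)"
    and hv: "h v = w"
    and hf: "\<And>i x y. x \<in> component word_crystal v \<Longrightarrow> y \<in> component word_crystal v \<Longrightarrow>
      word_f i x = Some y \<longleftrightarrow> word_f i (h x) = Some (h y)"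
    by (auto simp: crystal_equiv_def)
  have "sym (crystal_edges word_crystal)"
    by (auto simp: sym_def crystal_edges_def word_f_iff_e)
  then have sym: "sym ((crystal_edges word_crystal)\<^sup>*)"
    by (rule sym_rtrancl)
  have comp: "y \<in> component word_crystal x" "component word_crystal y = component word_crystal x"
    if "word_e i x = Some y" for x y
  proof -
    have "(x, y) \<in> (crystal_edges word_crystal)\<^sup>*"
      using that by (auto simp: crystal_edges_def)
    moreover from this sym have "(y, x) \<in> (crystal_edges word_crystal)\<^sup>*"
      by (auto dest: symD)
    ultimately show "y \<in> component word_crystal x"
      "component word_crystal y = component word_crystal x"
      by (auto simp: component_edges intro: rtrancl_trans)
  qed
  have self: "x \<in> component word_crystal x" for x
    by (auto simp: component_edges)
  have *: "word_e i w = Some (h x) \<longleftrightarrow> word_e i v = Some x" if "x \<in> component word_crystal v" for x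
    using hf[OF that self[of v], of i] hv by (simp add: word_f_iff_e)
  have equiv: "word_equiv x (h x)" if x: "word_e i v = Some x" for x
  proof -
    have hx: "word_e i w = Some (h x)" using * comp(1)[OF x] x by blast
    then have "word_wt x = word_wt (h x)"
      using word_wt_e[OF x] word_wt_e[OF hx] wt by simp
    with bij hf show ?thesis
      unfolding crystal_equiv_def comp(2)[OF x] comp(2)[OF hx] by auto
  qed
  show ?thesis
  proof (cases "word_e i v")
    case None
    have "word_e i w = None"
    proof (rule ccontr)
      assume "word_e i w \<noteq> None"
      then obtain y where y: "word_e i w = Some y" by blast
      then have "y \<in> h ` component word_crystal v"
        using bij comp(1) by (auto simp: bij_betw_def)
      then show False using * y None by auto
    qed
    with None show ?thesis by simp
  next
    case (Some x)
    then have "word_e i w = Some (h x)" using * comp(1) by blast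
    with Some equiv show ?thesis by simp
  qed
qed

text \<open>
  The congruence on words that the moves generate. The words modulo \<open>\<sim>\<close> are the
  monoid presented by the relations of \<open>\<U>(1)\<close>.
\<close>
inductive word_cong :: "letter list \<Rightarrow> letter list \<Rightarrow> bool" (infix "\<sim>" 50) where
  move: "basic_move v w \<Longrightarrow> p @ v @ q \<sim> p @ w @ q"
| cong_refl [simp, intro]: "w \<sim> w"
| cong_sym: "v \<sim> w \<Longrightarrow> w \<sim> v"
| cong_trans [trans]: "v \<sim> w \<Longrightarrow> w \<sim> x \<Longrightarrow> v \<sim> x"

lemma word_cong_context: "v \<sim> w \<Longrightarrow> p @ v @ q \<sim> p @ w @ q"
proof (induction rule: word_cong.induct)
  case (move v w p' q')
  from word_cong.move[OF this, of "p @ p'" "q' @ q"] show ?case by simp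
qed (auto intro: word_cong.intros)

lemma word_cong_append: "v \<sim> v' \<Longrightarrow> w \<sim> w' \<Longrightarrow> v @ w \<sim> v' @ w'"
  using word_cong_context[of v v' "[]" w] word_cong_context[of w w' v' "[]"]
  by (auto intro: word_cong.cong_trans)

lemma rel_option_mapI:
  assumes "rel_option R x y" "\<And>v w. R v w \<Longrightarrow> S (g v) (h w)"
  shows "rel_option S (map_option g x) (map_option h y)"
  using assms by (auto simp: option.rel_map intro: option.rel_mono_strong)

lemma rel_option_map_same:
  assumes "\<And>v. S (g v) (h v)"
  shows "rel_option S (map_option g x) (map_option h x)"
  using assms by (auto simp: option.rel_map intro: option.rel_refl)

lemma word_cong_eps_phi: "v \<sim> w \<Longrightarrow> word_eps i v = word_eps i w \<and> word_phi i v = word_phi i w"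
  by (induction rule: word_cong.induct)
    (auto simp: word_eps_phi_append basic_move_eps basic_move_phi)

lemma word_cong_wt: "v \<sim> w \<Longrightarrow> word_wt v = word_wt w"
  by (induction rule: word_cong.induct) (auto simp: basic_move_wt)

lemma rel_option_word_cong_refl: "rel_option (\<sim>) x x"
  by (rule option.rel_refl) auto

lemma rel_option_word_cong_sym: "rel_option (\<sim>) x y \<Longrightarrow> rel_option (\<sim>) y x"
  by (cases x; cases y) (auto intro: word_cong.cong_sym)

lemma rel_option_word_cong_trans:
  "rel_option (\<sim>) x y \<Longrightarrow> rel_option (\<sim>) y z \<Longrightarrow> rel_option (\<sim>) x z"
  by (cases x; cases y; cases z) (auto intro: word_cong.cong_trans)

text \<open>
  Since \<open>\<epsilon>\<close> and \<open>\<phi>\<close> agree on the two sides of a move, an operator acts at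
  corresponding positions of \<open>p @ v @ q\<close> and \<open>p @ w @ q\<close>: either on a common letter of
  \<open>p\<close> or \<open>q\<close>, or on the two sides of the move, which it takes to another move.
\<close>
lemma word_cong_e: "v \<sim> w \<Longrightarrow> rel_option (\<sim>) (word_e i v) (word_e i w)"
proof (induction rule: word_cong.induct)
  case (move v w p q)
  show ?case
    by (auto simp: word_e_append word_eps_phi_append basic_move_eps[OF move]
        basic_move_phi[OF move] option.map_comp comp_def
        intro!: rel_option_mapI[OF basic_move_e[OF move]] rel_option_map_same word_cong.move move)
qed (auto intro: rel_option_word_cong_refl rel_option_word_cong_sym rel_option_word_cong_trans)

lemma word_cong_f: "v \<sim> w \<Longrightarrow> rel_option (\<sim>) (word_f i v) (word_f i w)"
proof (induction rule: word_cong.induct)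
  case (move v w p q)
  show ?case
    by (auto simp: word_f_append word_eps_phi_append basic_move_eps[OF move]
        basic_move_phi[OF move] option.map_comp comp_def
        intro!: rel_option_mapI[OF basic_move_f[OF move]] rel_option_map_same word_cong.move move)
qed (auto intro: rel_option_word_cong_refl rel_option_word_cong_sym rel_option_word_cong_trans)

text \<open>
  The weights agree, and continue to agree along every sequence of raising
  operators. This is a common weakening of crystal equivalence and of \<open>\<sim>\<close>, and it is
  transitive, so that a chain of steps of both kinds can be followed upwards. The
  argument below recovers \<open>\<sim>\<close> from it.
\<close>
coinductive raise_equiv :: "letter list \<Rightarrow> letter list \<Rightarrow> bool" where
  "word_wt v = word_wt w \<Longrightarrow> (\<And>i. rel_option raise_equiv (word_e i v) (word_e i w)) \<Longrightarrow>
   raise_equiv v w"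
monos option.rel_mono_strong

lemma raise_equiv_of_word_equiv:
  assumes "word_equiv v w"
  shows "raise_equiv v w"
  using assms
proof (coinduction arbitrary: v w)
  case raise_equiv
  moreover from this have "word_wt v = word_wt w" by (simp add: crystal_equiv_def)
  ultimately show ?case
    by (auto intro: option.rel_mono_strong[OF word_equiv_e[OF raise_equiv]])
qed

lemma raise_equiv_of_word_cong:
  assumes "v \<sim> w"
  shows "raise_equiv v w"
  using assms
proof (coinduction arbitrary: v w)
  case raise_equiv
  then show ?case
    by (auto simp: word_cong_wt intro: option.rel_mono_strong[OF word_cong_e[OF raise_equiv]])
qed

lemma raise_equivD:
  assumes "raise_equiv v w"
  shows "word_wt v = word_wt w" "rel_option raise_equiv (word_e i v) (word_e i w)"
  using assms by (auto elim: raise_equiv.cases)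

lemma raise_equiv_trans:
  assumes "raise_equiv v w" "raise_equiv w x"
  shows "raise_equiv v x"
  using assms
proof (coinduction arbitrary: v w x)
  case raise_equiv
  have rel: "rel_option (raise_equiv OO raise_equiv) (word_e i v) (word_e i x)" for i
    using raise_equivD(2)[OF raise_equiv(1)] raise_equivD(2)[OF raise_equiv(2)]
    unfolding option.rel_compp by blast
  then show ?case
    using raise_equivD(1)[OF raise_equiv(1)] raise_equivD(1)[OF raise_equiv(2)]
    by (auto intro!: option.rel_mono_strong[OF rel])
qed

section \<open>Yamanouchi words\<close>

text \<open>
  The counts of the letters in a Yamanouchi word, and in each of its prefixes,
  form a partition. Rows are numbered from \<open>0\<close>, and appending a letter adds a box to
  its row.
\<close>
inductive yamanouchi :: "nat list \<Rightarrow> bool" where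
  Nil: "yamanouchi []"
| snoc: "yamanouchi y \<Longrightarrow> a = 0 \<or> count_list y a < count_list y (a - 1) \<Longrightarrow> yamanouchi (y @ [a])"

lemma yamanouchi_antimono: "yamanouchi y \<Longrightarrow> count_list y (Suc i) \<le> count_list y i"
  by (induction arbitrary: i rule: yamanouchi.induct) (auto simp: le_SucI)

lemma yamanouchi_snocD: "yamanouchi (y @ [a]) \<Longrightarrow> yamanouchi y"
  by (auto elim: yamanouchi.cases)

lemma yamanouchi_snocI:
  assumes "yamanouchi y" "\<And>i. count_list (y @ [a]) (Suc i) \<le> count_list (y @ [a]) i"
  shows "yamanouchi (y @ [a])"
  using assms(2)[of "a - 1"] by (intro yamanouchi.snoc assms) (cases a; simp)

lemma yamanouchi_prefixI:
  assumes "\<And>p q i. y = p @ q \<Longrightarrow> count_list p (Suc i) \<le> count_list p i"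
  shows "yamanouchi y"
  using assms
proof (induction y rule: rev_induct)
  case (snoc a y)
  have "yamanouchi y"
    by (rule snoc.IH, rule snoc.prems[of _ "_ @ [a]"]) simp
  then show ?case
    using snoc.prems[of "y @ [a]" "[]"] by (intro yamanouchi_snocI) auto
qed (rule yamanouchi.Nil)

text \<open>
  The witness is \<open>0\<^bsup>m 0\<^esup> 1\<^bsup>m 1\<^esup> \<dots>\<close>, which fills the partition row by row.
\<close>
lemma yamanouchi_exists:
  fixes m :: "nat \<Rightarrow> nat"
  assumes "\<And>i. m (Suc i) \<le> m i" "\<And>i. i \<ge> k \<Longrightarrow> m i = 0"
  shows "\<exists>y. yamanouchi y \<and> (\<forall>i. count_list y i = m i)"
  using assms
proof (induction k arbitrary: m)
  case 0
  then show ?case by (intro exI[of _ "[]"]) (auto intro: yamanouchi.Nil)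
next
  case (Suc k)
  have "\<exists>y. yamanouchi y \<and> (\<forall>i. count_list y i = (m(k := 0)) i)"
    using Suc.prems by (intro Suc.IH) (auto simp: le_Suc_eq)
  then obtain y where y: "yamanouchi y" "\<And>i. count_list y i = (m(k := 0)) i" by blast
  have count: "count_list (replicate j k) i = (if i = k then j else 0)" for i j
    by (induction j) auto
  have "yamanouchi (y @ replicate j k)" if "j \<le> m k" for j
    using that
  proof (induction j)
    case (Suc j)
    have "k = 0 \<or> m k \<le> m (k - 1)" using \<open>\<And>i. m (Suc i) \<le> m i\<close>[of "k - 1"] by (cases k) auto
    with Suc have "yamanouchi ((y @ replicate j k) @ [k])"
      by (intro yamanouchi.snoc) (auto simp: count y(2))
    then show ?case by (simp add: replicate_append_same)
  qed (simp add: y)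
  from this[OF order_refl] y(2) show ?case
    by (intro exI[of _ "y @ replicate (m k) k"]) (auto simp: count)
qed

text \<open>
  Two Yamanouchi words of the same content are joined by moves of a single type. This
  is clear by induction if they end in the same letter. Otherwise let \<open>a < b\<close> be the
  last letters of the two words. Removing from the common partition the corners in the
  rows \<open>a\<close> and \<open>b\<close> makes row \<open>b\<close> strictly shorter than row \<open>c = b - 1\<close>, so that row \<open>c\<close>
  ends in a corner, too. Let \<open>z\<close> be any Yamanouchi word for what remains if this corner
  is also removed. By induction the given words are congruent to \<open>z c b a\<close> and
  \<open>z c a b\<close>, and these two differ by a move since \<open>a \<le> c < b\<close>. The numbering \<open>g\<close> of
  the letters is a parameter because dual letters have to be counted downwards.
\<close>
lemma yamanouchi_cong:
  assumes swap: "\<And>a c b. a \<le> c \<Longrightarrow> c < b \<Longrightarrow> b < K \<Longrightarrow> [g c, g a, g b] \<sim> [g c, g b, g a]"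
    and "yamanouchi y" "yamanouchi y'" "\<And>i. count_list y i = count_list y' i"
    and "set y \<subseteq> {..<K}"
  shows "map g y \<sim> map g y'"
  using assms(2-)
proof (induction "length y" arbitrary: y y' rule: less_induct)
  case less
  have same: "length z = length z' \<and> set z = set z'"
    if "\<And>i. count_list z i = count_list z' i" for z z' :: "nat list"
  proof -
    have "mset z = mset z'" using that by (intro multiset_eqI) (simp add: count_mset)
    then show ?thesis by (metis mset_eq_length set_mset_mset)
  qed
  have *: "map g (w @ [a]) \<sim> map g (v @ [b])"
    if w: "yamanouchi (w @ [a])" and v: "yamanouchi (v @ [b])" and "a < b"
      and count: "\<And>i. count_list (w @ [a]) i = count_list (v @ [b]) i"
      and len: "length (w @ [a]) = length y" and set: "set (w @ [a]) \<subseteq> {..<K}" for w v a b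
  proof -
    define W V where "W = count_list w" and "V = count_list v"
    have WV: "W i + (if i = a then 1 else 0) = V i + (if i = b then 1 else 0)" for i
      using count[of i] by (auto simp: W_def V_def split: if_splits)
    have W: "W (Suc i) \<le> W i" for i
      unfolding W_def using w by (intro yamanouchi_antimono) (rule yamanouchi_snocD)
    have V: "V (Suc i) \<le> V i" for i
      unfolding V_def using v by (intro yamanouchi_antimono) (rule yamanouchi_snocD)
    have Wa: "W (Suc i) + (if Suc i = a then 1 else 0) \<le> W i + (if i = a then 1 else 0)" for i
      using yamanouchi_antimono[OF w, of i] by (auto simp: W_def split: if_splits)
    obtain c where b: "b = Suc c" using \<open>a < b\<close> by (cases b) auto
    then have "a \<le> c" using \<open>a < b\<close> by simp
    have Wb: "W b = Suc (V b)" using WV[of b] \<open>a < b\<close> by simp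
    have WSb: "W (Suc b) = V (Suc b)" using WV[of "Suc b"] \<open>a < b\<close> by simp
    \<comment> \<open>the partition without its corners in the rows \<open>a\<close>, \<open>b\<close> and \<open>c\<close>\<close>
    define N where "N i = W i - (if i = b \<or> i = c then 1 else 0)" for i
    have Wc: "W c \<ge> W b" using W[of c] b by simp
    have "\<exists>y. yamanouchi y \<and> (\<forall>i. count_list y i = N i)"
    proof (rule yamanouchi_exists)
      show "N (Suc i) \<le> N i" for i
        using W[of i] V[of i] Wb WSb Wc b by (auto simp: N_def)
      show "N i = 0" if "i \<ge> K" for i
      proof -
        from that set have "i \<notin> set w" by auto
        then show ?thesis by (simp add: N_def W_def)
      qed
    qed
    then obtain z where z: "yamanouchi z" "\<And>i. count_list z i = N i" by blast
    have zc: "yamanouchi (z @ [c])"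
      using W V Wb WSb Wc b z by (intro yamanouchi_snocI) (auto simp: N_def)
    have count_b: "count_list ((z @ [c]) @ [b]) i = W i" for i
      using z(2)[of i] Wb Wc b by (auto simp: N_def)
    have count_a: "count_list ((z @ [c]) @ [a]) i = V i" for i
      using z(2)[of i] Wb Wc b WV[of i] by (auto simp: N_def split: if_splits)
    have "set (v @ [b]) = set (w @ [a])" using same[OF count] by simp
    with set have setv: "set (v @ [b]) \<subseteq> {..<K}" by (simp only:)
    have "yamanouchi ((z @ [c]) @ [b])"
      by (rule yamanouchi_snocI[OF zc]) (simp only: count_b W)
    then have "map g w \<sim> map g ((z @ [c]) @ [b])"
      using len set count_b w by (intro less.hyps) (auto simp: W_def dest: yamanouchi_snocD)
    from word_cong_append[OF this, of "[g a]" "[g a]"]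
    have 1: "map g (w @ [a]) \<sim> map g z @ [g c, g b, g a]" by simp
    have "yamanouchi ((z @ [c]) @ [a])"
      by (rule yamanouchi_snocI[OF zc]) (simp only: count_a V)
    then have "map g v \<sim> map g ((z @ [c]) @ [a])"
      using len setv count_a v same[OF count]
      by (intro less.hyps) (auto simp: V_def dest: yamanouchi_snocD)
    from word_cong_append[OF this, of "[g b]" "[g b]"]
    have 2: "map g (v @ [b]) \<sim> map g z @ [g c, g a, g b]" by simp
    have "b < K" using setv by simp
    with swap[of a c b] \<open>a \<le> c\<close> b have "map g z @ [g c, g a, g b] \<sim> map g z @ [g c, g b, g a]"
      by (intro word_cong_append) auto
    with 1 2 show ?thesis by (blast intro: word_cong.cong_trans word_cong.cong_sym)
  qed
  show ?case
  proof (cases y rule: rev_cases)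
    case Nil
    then show ?thesis using same[OF less.prems(3)] by auto
  next
    case (snoc w a)
    then obtain v b where y': "y' = v @ [b]"
      using same[OF less.prems(3)] by (cases y' rule: rev_cases) auto
    consider "a < b" | "b < a" | "a = b" by linarith
    then show ?thesis
    proof cases
      case 1
      then show ?thesis using * less.prems snoc y' by blast
    next
      case 2
      have "length y' = length y" "set y' = set y" using same[OF less.prems(3)] by auto
      then have "map g (v @ [b]) \<sim> map g (w @ [a])"
        using 2 less.prems unfolding snoc y' by (intro *) (simp_all add: snoc)
      then show ?thesis unfolding snoc y' by (rule word_cong.cong_sym)
    next
      case 3
      have "map g w \<sim> map g v"
      proof (rule less.hyps)
        show "count_list w i = count_list v i" for i
          using less.prems(3)[of i] snoc y' 3 by (auto split: if_splits)
      qed (use less.prems snoc y' in \<open>auto dest: yamanouchi_snocD\<close>)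
      from word_cong_append[OF this, of "[g a]" "[g a]"] show ?thesis
        using snoc y' 3 by simp
    qed
  qed
qed

section \<open>From crystal equivalence to congruence\<close>

lemma num_One_or_succ: "i = num.One \<or> (\<exists>k. i = k + num.One)"
  by (induction i rule: num_induct) (auto simp: add_One)

text \<open>
  A letter passes a dual letter of a different index. If it meets its own dual, the
  pair is either erased or, for index \<open>k + 1\<close>, turned into the pair of index \<open>k\<close> in the
  opposite order; in each case it remains to pass a shorter word.
\<close>
lemma word_cong_Inl_past_Inr: "\<exists>v' w'. Inl i # map Inr v \<sim> map Inr v' @ map Inl w'"
proof (induction v arbitrary: i)
  case Nil
  have "Inl i # map Inr [] \<sim> map Inr [] @ map Inl [i]" by simp
  then show ?case by blast
next
  case (Cons j v)
  have move: "Inl i # map Inr (j # v) \<sim> w @ map Inr v" if "basic_move [Inl i, Inr j] w" for w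
    using word_cong.move[OF that, of "[]" "map Inr v"] by simp
  have step: ?case if "basic_move [Inl i, Inr j] [Inr j', Inl i']" for i' j'
  proof -
    from Cons.IH obtain v' w' where "Inl i' # map Inr v \<sim> map Inr v' @ map Inl w'" by blast
    from word_cong_append[OF word_cong.cong_refl[of "[Inr j']"] this] move[OF that]
    have "Inl i # map Inr (j # v) \<sim> map Inr (j' # v') @ map Inl w'"
      by (auto intro: word_cong.cong_trans)
    then show ?thesis by blast
  qed
  consider "i \<noteq> j" | k where "i = k + num.One" "j = k + num.One" | "i = num.One" "j = num.One"
    using num_One_or_succ[of i] by blast
  then show ?case
  proof cases
    case 1
    then show ?thesis using basic_move.intros(7) step by blast
  next
    case 2
    then show ?thesis using basic_move.intros(5) step by blast
  next
    case 3
    then have "Inl i # map Inr (j # v) \<sim> map Inr v @ map Inl []"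
      using move[of "[]"] basic_move.intros(6) by simp
    then show ?thesis by blast
  qed
qed

lemma word_cong_normal_form: "\<exists>v w. x \<sim> map Inr v @ map Inl w"
proof (induction x)
  case Nil
  have "[] \<sim> map Inr [] @ map Inl []" by simp
  then show ?case by blast
next
  case (Cons a x)
  then obtain v w where x: "x \<sim> map Inr v @ map Inl w" by blast
  from word_cong_append[OF word_cong.cong_refl[of "[a]"] x]
  have ax: "a # x \<sim> (a # map Inr v) @ map Inl w" by simp
  show ?case
  proof (cases a)
    case (Inl i)
    obtain v' w' where "a # map Inr v \<sim> map Inr v' @ map Inl w'"
      using word_cong_Inl_past_Inr Inl by blast
    from word_cong_append[OF this word_cong.cong_refl[of "map Inl w"]] ax
    have "a # x \<sim> map Inr v' @ map Inl (w' @ w)" by (auto intro: word_cong.cong_trans)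
    then show ?thesis by blast
  next
    case (Inr j)
    with ax have "a # x \<sim> map Inr (j # v) @ map Inl w" by simp
    then show ?thesis by blast
  qed
qed

text \<open>The axiom \<open>\<phi>\<^sub>i = \<langle>wt, h\<^sub>i\<rangle> + \<epsilon>\<^sub>i\<close>, separately for the two kinds of words.\<close>
lemma phi_minus_eps_Inl:
  "word_phi i (map Inl w) + count_list w (i + num.One) = word_eps i (map Inl w) + count_list w i"
  by (induction w) (auto simp: letter_eps_def letter_phi_def)

lemma phi_minus_eps_Inr:
  "word_phi i (map Inr v) + count_list v i = word_eps i (map Inr v) + count_list v (i + num.One)"
  by (induction v) (auto simp: letter_eps_def letter_phi_def)

lemma eps_Inl_le: "word_eps i (map Inl w) \<le> count_list w (i + num.One)"
  by (induction w) (auto simp: letter_eps_def letter_phi_def)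

lemma phi_Inr_le: "word_phi i (map Inr v) \<le> count_list v (i + num.One)"
  by (induction v) (auto simp: letter_eps_def letter_phi_def)

lemma word_e_Inl:
  "word_e i (map Inl w) = Some x \<Longrightarrow> \<exists>p q. w = p @ (i + num.One) # q \<and> x = map Inl (p @ i # q)"
proof (induction w arbitrary: x)
  case (Cons j w)
  show ?case
  proof (cases "word_eps i (map Inl w) \<le> letter_phi i (Inl j)")
    case True
    with Cons.prems show ?thesis
      by (intro exI[of _ "[]"] exI[of _ w]) (auto split: if_splits)
  next
    case False
    with Cons.prems obtain z where z: "word_e i (map Inl w) = Some z" "x = Inl j # z" by auto
    from Cons.IH[OF z(1)] obtain p q where "w = p @ (i + num.One) # q" "z = map Inl (p @ i # q)"
      by blast
    with z show ?thesis by (intro exI[of _ "j # p"] exI[of _ q]) auto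
  qed
qed simp

lemma word_e_Inr:
  "word_e i (map Inr v) = Some x \<Longrightarrow> \<exists>p q. v = p @ i # q \<and> x = map Inr (p @ (i + num.One) # q)"
proof (induction v arbitrary: x)
  case (Cons j v)
  show ?case
  proof (cases "word_eps i (map Inr v) \<le> letter_phi i (Inr j)")
    case True
    with Cons.prems show ?thesis
      by (intro exI[of _ "[]"] exI[of _ v]) (auto split: if_splits)
  next
    case False
    with Cons.prems obtain z where z: "word_e i (map Inr v) = Some z" "x = Inr j # z" by auto
    from Cons.IH[OF z(1)] obtain p q where "v = p @ i # q" "z = map Inr (p @ (i + num.One) # q)"
      by blast
    with z show ?thesis by (intro exI[of _ "j # p"] exI[of _ q]) auto
  qed
qed simp

text \<open>
  The room \<open>N - n \<ge> length v\<close> above \<open>n\<close> is what allows all dual letters to be raised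
  above \<open>n\<close> by the operators \<open>e\<^sub>i\<close> with \<open>i < N\<close>, whereas the ordinary letters never
  leave \<open>{1, \<dots>, n}\<close>.
\<close>
definition normal_bounded :: "nat \<Rightarrow> nat \<Rightarrow> num list \<Rightarrow> num list \<Rightarrow> bool" where
  "normal_bounded n N v w \<longleftrightarrow>
     (\<forall>j\<in>set v. nat_of_num j \<le> N) \<and> (\<forall>j\<in>set w. nat_of_num j \<le> n) \<and> n + length v \<le> N"

definition raise_measure :: "nat \<Rightarrow> num list \<Rightarrow> num list \<Rightarrow> nat" where
  "raise_measure N v w = (\<Sum>j\<leftarrow>v. N - nat_of_num j) + (\<Sum>j\<leftarrow>w. nat_of_num j)"

text \<open>
  A raising operator replaces a letter \<open>i + 1\<close> by \<open>i\<close> or a dual letter \<open>i\<^sup>\<or>\<close> by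
  \<open>(i + 1)\<^sup>\<or>\<close>. Below \<open>N\<close> this can only be repeated finitely often.
\<close>
lemma word_e_normal:
  assumes "word_e i (map Inr v @ map Inl w) = Some x" "nat_of_num i < N" "normal_bounded n N v w"
  shows "\<exists>v' w'. x = map Inr v' @ map Inl w' \<and> normal_bounded n N v' w' \<and>
    raise_measure N v' w' < raise_measure N v w"
proof (cases "word_eps i (map Inl w :: letter list) \<le> word_phi i (map Inr v)")
  case True
  with assms(1) obtain z where z: "word_e i (map Inr v) = Some z" "x = z @ map Inl w"
    by (auto simp: word_e_append)
  from word_e_Inr[OF z(1)] obtain p q where v: "v = p @ i # q"
    "z = map Inr (p @ (i + num.One) # q)" by blast
  show ?thesis
    using assms v z
    by (intro exI[of _ "p @ (i + num.One) # q"] exI[of _ w])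
      (auto simp: normal_bounded_def raise_measure_def nat_of_num_add)
next
  case False
  with assms(1) obtain z where z: "word_e i (map Inl w) = Some z" "x = map Inr v @ z"
    by (auto simp: word_e_append)
  from word_e_Inl[OF z(1)] obtain p q where w: "w = p @ (i + num.One) # q"
    "z = map Inl (p @ i # q)" by blast
  show ?thesis
    using assms w z
    by (intro exI[of _ v] exI[of _ "p @ i # q"])
      (auto simp: normal_bounded_def raise_measure_def nat_of_num_add)
qed

lemma count_list_map_inv:
  "(\<And>x. x \<in> set xs \<Longrightarrow> f x = k \<longleftrightarrow> x = j) \<Longrightarrow> count_list (map f xs) k = count_list xs j"
  by (induction xs) auto

text \<open>
  A highest weight element for the operators \<open>e\<^sub>i\<close> with \<open>i < N\<close>. By the tensor product
  rule its left factor is of highest weight as well, so that in each prefix of \<open>v\<close>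
  there are at most as many letters \<open>i\<^sup>\<or>\<close> as letters \<open>(i + 1)\<^sup>\<or>\<close>. If a letter \<open>j \<le> n\<close>
  occurred in \<open>v\<close>, then all of \<open>j, \<dots>, N\<close> would, which are more than the length of \<open>v\<close>.
  So the letters of \<open>v\<close> and \<open>w\<close> are separated by \<open>n\<close>, the two factors do not interact,
  and both are Yamanouchi words, up to a renumbering of the letters.
\<close>
locale fully_raised =
  fixes n N :: nat and v w :: "num list"
  assumes bounded: "normal_bounded n N v w"
    and raised: "\<And>i. nat_of_num i < N \<Longrightarrow> word_e i (map Inr v @ map Inl w) = None"
begin

lemma eps_Inr: "word_eps i (map Inr v) = 0" if "nat_of_num i < N"
  using raised[OF that] by (simp add: word_e_None word_eps_phi_append)

lemma count_prefix_Inr: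
  assumes "nat_of_num i < N" "v = p @ q"
  shows "count_list p i \<le> count_list p (i + num.One)"
  using eps_Inr[OF assms(1)] phi_minus_eps_Inr[of i p] by (simp add: assms(2) word_eps_phi_append)

lemma letters_Inr: "j \<in> set v \<Longrightarrow> n < nat_of_num j"
proof (rule ccontr)
  assume j: "j \<in> set v" and "\<not> n < nat_of_num j"
  have "num_of_nat k \<in> set v" if "nat_of_num j \<le> k" "k \<le> N" for k
    using that
  proof (induction k rule: dec_induct)
    case base
    then show ?case using j by (simp add: nat_of_num_inverse)
  next
    case (step k)
    have "nat_of_num (num_of_nat k) = k"
      using step nat_of_num_pos[of j] by (simp add: num_of_nat_inverse)
    then have "count_list v (num_of_nat k) \<le> count_list v (num_of_nat (Suc k))"
      using count_prefix_Inr[of "num_of_nat k" v "[]"] step nat_of_num_pos[of j]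
      by (simp add: add_One)
    then show ?case using step by (metis Suc_leD count_list_0_iff le_zero_eq)
  qed
  \<comment> \<open>so \<open>v\<close> has at least \<open>N - j + 1 > N - n\<close> letters\<close>
  then have "num_of_nat ` {nat_of_num j..N} \<subseteq> set v" by auto
  moreover have "inj_on num_of_nat {nat_of_num j..N}"
    using nat_of_num_pos[of j]
    by (intro inj_on_inverseI[of _ nat_of_num]) (auto simp: num_of_nat_inverse)
  ultimately have "card {nat_of_num j..N} \<le> length v"
    by (metis card_image card_length card_mono List.finite_set le_trans)
  then show False using bounded \<open>\<not> n < nat_of_num j\<close> by (auto simp: normal_bounded_def)
qed

text \<open>
  The operators below \<open>n\<close> see no letter of \<open>v\<close>, so it is \<open>w\<close> that they cannot raise;
  the operators from \<open>n\<close> on have nothing to raise in \<open>w\<close>.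
\<close>
lemma eps_Inl: "word_eps i (map Inl w) = 0"
proof (cases "nat_of_num i < n")
  case True
  then have "i + num.One \<notin> set v" using letters_Inr[of "i + num.One"] by (auto simp: nat_of_num_add)
  then have "word_phi i (map Inr v) = 0" using phi_Inr_le[of i v] by simp
  moreover have "nat_of_num i < N" using True bounded by (simp add: normal_bounded_def)
  ultimately show ?thesis using raised[of i] by (simp add: word_e_None word_eps_phi_append)
next
  case False
  then have "i + num.One \<notin> set w" using bounded by (auto simp: normal_bounded_def nat_of_num_add)
  then show ?thesis using eps_Inl_le[of i w] by simp
qed

lemma count_prefix_Inl:
  assumes "w = p @ q"
  shows "count_list p (i + num.One) \<le> count_list p i"
  using eps_Inl phi_minus_eps_Inl[of i p] by (simp add: assms word_eps_phi_append)

lemma count_Inl_index: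
  "count_list (map (\<lambda>i. nat_of_num i - 1) x) k = count_list x (num_of_nat (Suc k))"
proof (rule count_list_map_inv)
  show "nat_of_num i - 1 = k \<longleftrightarrow> i = num_of_nat (Suc k)" for i
    using nat_of_num_pos[of i] num_of_nat_inverse[of "Suc k"]
    by (auto simp: num_eq_iff simp del: num_of_nat.simps)
qed

lemma count_Inr_index:
  assumes "\<forall>j\<in>set x. nat_of_num j \<le> N"
  shows "count_list (map (\<lambda>i. N - nat_of_num i) x) k =
    (if k < N then count_list x (num_of_nat (N - k)) else 0)"
proof (cases "k < N")
  case True
  have "count_list (map (\<lambda>i. N - nat_of_num i) x) k = count_list x (num_of_nat (N - k))"
  proof (rule count_list_map_inv)
    show "N - nat_of_num i = k \<longleftrightarrow> i = num_of_nat (N - k)" if "i \<in> set x" for i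
      using assms that True by (auto simp: num_eq_iff num_of_nat_inverse)
  qed
  with True show ?thesis by simp
next
  case False
  have "k \<notin> (\<lambda>i. N - nat_of_num i) ` set x"
  proof
    assume "k \<in> (\<lambda>i. N - nat_of_num i) ` set x"
    then obtain i where "k = N - nat_of_num i" "i \<in> set x" by blast
    then show False using False assms nat_of_num_pos[of i] by auto
  qed
  with False show ?thesis by simp
qed

lemma yamanouchi_Inl: "yamanouchi (map (\<lambda>i. nat_of_num i - 1) w)"
proof (rule yamanouchi_prefixI)
  fix p q k
  assume "map (\<lambda>i. nat_of_num i - 1) w = p @ q"
  then obtain p' q' where "w = p' @ q'" "p = map (\<lambda>i. nat_of_num i - 1) p'"
    by (auto simp: map_eq_append_conv)
  then show "count_list p (Suc k) \<le> count_list p k"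
    using count_prefix_Inl[of p' q' "num_of_nat (Suc k)"] by (simp only: count_Inl_index) (simp add: add_One)
qed

lemma yamanouchi_Inr: "yamanouchi (map (\<lambda>i. N - nat_of_num i) v)"
proof (rule yamanouchi_prefixI)
  fix p q k
  assume "map (\<lambda>i. N - nat_of_num i) v = p @ q"
  then obtain p' q' where v: "v = p' @ q'" and p: "p = map (\<lambda>i. N - nat_of_num i) p'"
    by (auto simp: map_eq_append_conv)
  have p': "\<forall>j\<in>set p'. nat_of_num j \<le> N" using bounded v by (auto simp: normal_bounded_def)
  show "count_list p (Suc k) \<le> count_list p k"
  proof (cases "Suc k < N")
    case True
    define i where "i = num_of_nat (N - Suc k)"
    have "nat_of_num i = N - Suc k" using True by (simp add: i_def num_of_nat_inverse)
    moreover from this True have "i + num.One = num_of_nat (N - k)"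
      by (simp add: num_eq_iff nat_of_num_add num_of_nat_inverse)
    ultimately show ?thesis
      using count_prefix_Inr[of i p' q'] v True by (simp add: p count_Inr_index[OF p'] i_def)
  qed (simp add: p count_Inr_index[OF p'])
qed

end

lemma word_wt_Inl: "Poly_Mapping.lookup (word_wt (map Inl w)) i = int (count_list w i)"
  by (induction w) (auto simp: lookup_add lookup_single lookup_minus)

lemma word_wt_Inr: "Poly_Mapping.lookup (word_wt (map Inr v)) i = - int (count_list v i)"
  by (induction v) (auto simp: lookup_add lookup_single lookup_minus)

text \<open>
  No letter of \<open>w\<close> cancels a dual letter of \<open>v\<close> in the weight, because they are
  separated by \<open>n\<close>. So the weight determines the contents of \<open>v\<close> and \<open>w\<close>, and these
  determine the Yamanouchi words \<open>v\<close> and \<open>w\<close> up to \<open>\<sim>\<close>.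
\<close>
lemma word_cong_if_fully_raised:
  assumes "fully_raised n N v w" "fully_raised n N v' w'"
    and wt: "word_wt (map Inr v @ map Inl w) = word_wt (map Inr v' @ map Inl w')"
  shows "map Inr v @ map Inl w \<sim> map Inr v' @ map Inl w'"
proof -
  interpret A: fully_raised n N v w by fact
  interpret B: fully_raised n N v' w' by fact
  have diff: "int (count_list w i) - int (count_list v i) =
      int (count_list w' i) - int (count_list v' i)" for i
    using arg_cong[OF wt, of "\<lambda>x. Poly_Mapping.lookup x i"] by (simp add: lookup_add word_wt_Inl word_wt_Inr)
  have count: "count_list w i = count_list w' i \<and> count_list v i = count_list v' i" for i
  proof (cases "nat_of_num i \<le> n")
    case True
    then have "i \<notin> set v" "i \<notin> set v'" using A.letters_Inr[of i] B.letters_Inr[of i] by auto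
    then show ?thesis using diff[of i] by simp
  next
    case False
    then have "i \<notin> set w" "i \<notin> set w'"
      using A.bounded B.bounded by (auto simp: normal_bounded_def)
    then show ?thesis using diff[of i] by simp
  qed
  have vN: "\<forall>j\<in>set v. nat_of_num j \<le> N" "\<forall>j\<in>set v'. nat_of_num j \<le> N"
    using A.bounded B.bounded by (auto simp: normal_bounded_def)
  \<comment> \<open>letters are numbered upwards from \<open>1\<close>, dual letters downwards from \<open>N\<close>\<close>
  define l :: "num \<Rightarrow> nat" where "l i = nat_of_num i - 1" for i
  define r :: "num \<Rightarrow> nat" where "r i = N - nat_of_num i" for i
  define gl :: "nat \<Rightarrow> letter" where "gl k = Inl (num_of_nat (Suc k))" for k
  define gr :: "nat \<Rightarrow> letter" where "gr k = Inr (num_of_nat (N - k))" for k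
  have Inl: "map gl (map l w) \<sim> map gl (map l w')"
  proof (rule yamanouchi_cong)
    show "[gl c, gl a, gl b] \<sim> [gl c, gl b, gl a]" if "a \<le> c" "c < b" "b < n" for a b c
      using word_cong.move[OF basic_move.intros(1), of _ _ _ "[]" "[]"] that
      by (simp add: gl_def num_to_nat num_of_nat_inverse del: num_of_nat.simps)
    show "set (map l w) \<subseteq> {..<n}"
    proof -
      have "nat_of_num j - 1 < n" if "j \<in> set w" for j
        using A.bounded that nat_of_num_pos[of j] by (fastforce simp: normal_bounded_def)
      then show ?thesis by (auto simp: l_def)
    qed
  qed (use A.yamanouchi_Inl B.yamanouchi_Inl count in \<open>auto simp: l_def[abs_def] A.count_Inl_index simp del: One_nat_def num_of_nat.simps\<close>)
  have gl: "map gl (map l x) = map Inl x" for x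
    by (simp add: gl_def l_def nat_of_num_pos nat_of_num_inverse)
  have Inr: "map gr (map r v) \<sim> map gr (map r v')"
  proof (rule yamanouchi_cong)
    show "[gr c, gr a, gr b] \<sim> [gr c, gr b, gr a]" if "a \<le> c" "c < b" "b < N" for a b c
      using word_cong.cong_sym[OF word_cong.move[OF basic_move.intros(4), of _ _ _ "[]" "[]"]] that
      by (simp add: gr_def num_to_nat num_of_nat_inverse)
    show "set (map r v) \<subseteq> {..<N}"
    proof -
      have "N - nat_of_num j < N" if "j \<in> set v" for j
        using vN(1) that nat_of_num_pos[of j] by fastforce
      then show ?thesis by (auto simp: r_def)
    qed
  qed (use A.yamanouchi_Inr B.yamanouchi_Inr count vN in
      \<open>auto simp: r_def[abs_def] A.count_Inr_index\<close>)
  have gr: "map gr (map r x) = map Inr x" if "\<forall>j\<in>set x. nat_of_num j \<le> N" for x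
    using that by (simp add: gr_def r_def nat_of_num_inverse)
  from Inr have "map Inr v \<sim> map Inr v'" unfolding gr[OF vN(1)] gr[OF vN(2)] .
  moreover from Inl have "map Inl w \<sim> map Inl w'" unfolding gl .
  ultimately show ?thesis by (rule word_cong_append)
qed

text \<open>
  The two words are raised simultaneously until no \<open>e\<^sub>i\<close> with \<open>i < N\<close> applies to either.
  There they are congruent, and the operators \<open>f\<^sub>i\<close>, which are compatible with \<open>\<sim>\<close>,
  carry the congruence back down.
\<close>
lemma word_cong_of_raise_equiv_normal:
  assumes "raise_equiv (map Inr v @ map Inl w) (map Inr v' @ map Inl w')"
    and "normal_bounded n N v w" "normal_bounded n N v' w'"
  shows "map Inr v @ map Inl w \<sim> map Inr v' @ map Inl w'"
  using assms
proof (induction "raise_measure N v w" arbitrary: v w v' w' rule: less_induct)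
  case less
  let ?x = "map Inr v @ map Inl w" and ?y = "map Inr v' @ map Inl w'"
  show ?case
  proof (cases "\<exists>i x'. nat_of_num i < N \<and> word_e i ?x = Some x'")
    case True
    then obtain i x' where i: "nat_of_num i < N" and x': "word_e i ?x = Some x'" by blast
    with raise_equivD(2)[OF less.prems(1), of i] obtain y'
      where y': "word_e i ?y = Some y'" and eq: "raise_equiv x' y'"
      by (auto simp: option_rel_Some1)
    from word_e_normal[OF x' i less.prems(2)] word_e_normal[OF y' i less.prems(3)] eq
    have "x' \<sim> y'" using less.hyps by blast
    from word_cong_f[OF this, of i] x' y' show ?thesis
      by (simp add: word_f_iff_e[THEN iffD2])
  next
    case False
    then have x: "word_e i ?x = None" if "nat_of_num i < N" for i using that by fastforce
    then have "word_e i ?y = None" if "nat_of_num i < N" for i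
      using that raise_equivD(2)[OF less.prems(1), of i] by simp
    with x less.prems show ?thesis
      using raise_equivD(1)[OF less.prems(1)]
      by (intro word_cong_if_fully_raised[of n N]) (auto simp: fully_raised_def)
  qed
qed

theorem word_cong_if_word_equiv:
  assumes "word_equiv x y"
  shows "x \<sim> y"
proof -
  obtain v w where x: "x \<sim> map Inr v @ map Inl w" using word_cong_normal_form by blast
  obtain v' w' where y: "y \<sim> map Inr v' @ map Inl w'" using word_cong_normal_form by blast
  \<comment> \<open>any common bound of the letters would do for \<open>n\<close>\<close>
  define n where "n = (\<Sum>j\<leftarrow>v @ w @ v' @ w'. nat_of_num j)"
  define N where "N = n + length v + length v'"
  have "nat_of_num j \<le> n" if "j \<in> set (v @ w @ v' @ w')" for j
    unfolding n_def using that by (intro member_le_sum_list) auto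
  then have "normal_bounded n N v w" "normal_bounded n N v' w'"
    by (auto simp: normal_bounded_def N_def trans_le_add1)
  moreover have "raise_equiv (map Inr v @ map Inl w) (map Inr v' @ map Inl w')"
    using raise_equiv_of_word_cong[OF word_cong.cong_sym[OF x]] raise_equiv_of_word_equiv[OF assms]
      raise_equiv_of_word_cong[OF y] by (blast intro: raise_equiv_trans)
  ultimately have "map Inr v @ map Inl w \<sim> map Inr v' @ map Inl w'"
    by (intro word_cong_of_raise_equiv_normal)
  with x y show ?thesis by (blast intro: word_cong.cong_trans word_cong.cong_sym)
qed

section \<open>Quotients by generated ideals\<close>

lemma free_algebra_simps [simp]:
  "carrier free_algebra = UNIV" "monoid.mult free_algebra = (*)" "monoid.one free_algebra = 1"
  "ring.zero free_algebra = 0" "ring.add free_algebra = (+)" "module.smult free_algebra c p = scalar c * p"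
  by (simp_all add: free_algebra_def)

lemma ring_record_cong:
  assumes "ring R" "carrier S = carrier R" "monoid.mult S = monoid.mult R" "monoid.one S = monoid.one R"
    "ring.zero S = ring.zero R" "ring.add S = ring.add R"
  shows "ring S"
proof -
  interpret ring R by fact
  show ?thesis
    using assms(2-)
    by (intro ringI abelian_groupI monoidI)
      (auto simp: m_assoc a_assoc a_comm a_lcomm l_distr r_distr l_neg intro: a_inv_closed)
qed

lemma quotient_algebra_simps:
  "carrier (quotient_algebra A I) = carrier (A Quot I)"
  "monoid.mult (quotient_algebra A I) = monoid.mult (A Quot I)"
  "monoid.one (quotient_algebra A I) = monoid.one (A Quot I)"
  "ring.zero (quotient_algebra A I) = ring.zero (A Quot I)"
  "ring.add (quotient_algebra A I) = ring.add (A Quot I)"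
  "module.smult (quotient_algebra A I) c C = (\<Union>x\<in>C. I +>\<^bsub>A\<^esub> (c \<odot>\<^bsub>A\<^esub> x))"
  by (simp_all add: quotient_algebra_def ring.defs module.defs)

lemma restrict_scalars_simps:
  "carrier (restrict_scalars h A) = carrier A"
  "monoid.mult (restrict_scalars h A) = monoid.mult A"
  "monoid.one (restrict_scalars h A) = monoid.one A"
  "ring.zero (restrict_scalars h A) = ring.zero A"
  "ring.add (restrict_scalars h A) = ring.add A"
  "module.smult (restrict_scalars h A) c x = h c \<odot>\<^bsub>A\<^esub> x"
  by (simp_all add: restrict_scalars_def ring.defs module.defs)

lemma ring_restrict_scalars: "ring A \<Longrightarrow> ring (restrict_scalars h A)"
  by (erule ring_record_cong) (simp_all add: restrict_scalars_simps)

text \<open>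
  The specialized algebra is a quotient of a quotient, so the construction is needed
  for the free algebra as well as for \<open>\<U>(t)\<close>.
\<close>
locale generated_quotient = ring A for A :: "('k, 'a, 'm) module_scheme" (structure) +
  fixes S :: "'a set"
  assumes generators: "S \<subseteq> carrier A"
begin

abbreviation "quot \<equiv> quotient_algebra A (Idl S)"

abbreviation proj :: "'a \<Rightarrow> 'a set" where
  "proj x \<equiv> Idl S +> x"

sublocale I: ideal "Idl S" A
  using generators by (rule genideal_ideal)

lemma ring_quot: "ring quot"
  by (rule ring_record_cong[OF I.quotient_is_ring]) (simp_all add: quotient_algebra_simps)

lemma carrier_quot: "carrier quot = proj ` carrier A"
  by (auto simp: quotient_algebra_simps FactRing_simps)

lemma hom_proj: "ring_hom_ring A quot proj"
proof (rule ring_hom_ringI2[OF ring_axioms ring_quot])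
  show "proj \<in> ring_hom A quot"
    using I.rcos_ring_hom by (simp add: ring_hom_def quotient_algebra_simps)
qed

lemma hom_eq_if_proj_eq:
  assumes "ring_hom_ring A B f" "\<And>s. s \<in> S \<Longrightarrow> f s = \<zero>\<^bsub>B\<^esub>"
    and "x \<in> carrier A" "y \<in> carrier A" "proj x = proj y"
  shows "f x = f y"
proof -
  interpret h: ring_hom_ring A B f by fact
  have "S \<subseteq> a_kernel A B f"
    unfolding a_kernel_def' using generators assms(2) by blast
  then have kernel: "Idl S \<subseteq> a_kernel A B f"
    by (rule genideal_minimal[OF h.kernel_is_ideal])
  have "x \<in> Idl S +> y"
    using I.a_rcos_self[OF assms(3)] assms(5) by simp
  then obtain k where k: "k \<in> Idl S" "x = k \<oplus> y"
    unfolding a_r_coset_def' by blast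
  with kernel have "k \<in> carrier A" "f k = \<zero>\<^bsub>B\<^esub>"
    unfolding a_kernel_def' by blast+
  with assms(4) k(2) show ?thesis by simp
qed

lemma induced_hom:
  assumes f: "ring_hom_ring A B f" and zero: "\<And>s. s \<in> S \<Longrightarrow> f s = \<zero>\<^bsub>B\<^esub>"
  obtains \<tau> where "ring_hom_ring quot B \<tau>" "\<And>x. x \<in> carrier A \<Longrightarrow> \<tau> (proj x) = f x"
proof -
  interpret h: ring_hom_ring A B f by fact
  interpret p: ring_hom_ring A quot proj by (rule hom_proj)
  define \<tau> where "\<tau> C = f (SOME x. x \<in> carrier A \<and> proj x = C)" for C
  have \<tau>: "\<tau> (proj x) = f x" if "x \<in> carrier A" for x
    unfolding \<tau>_def
    by (rule someI2[of _ x]) (use that in \<open>auto intro: hom_eq_if_proj_eq[OF f zero]\<close>)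
  have "\<tau> \<in> ring_hom quot B"
  proof (rule ring_hom_memI)
    fix C D assume "C \<in> carrier quot" "D \<in> carrier quot"
    then obtain x y where xy: "x \<in> carrier A" "y \<in> carrier A" "C = proj x" "D = proj y"
      by (auto simp: carrier_quot)
    show "\<tau> (C \<otimes>\<^bsub>quot\<^esub> D) = \<tau> C \<otimes>\<^bsub>B\<^esub> \<tau> D"
      using xy by (simp add: \<tau> flip: p.hom_mult)
    show "\<tau> (C \<oplus>\<^bsub>quot\<^esub> D) = \<tau> C \<oplus>\<^bsub>B\<^esub> \<tau> D"
      using xy by (simp add: \<tau> flip: p.hom_add)
  next
    show "\<tau> C \<in> carrier B" if "C \<in> carrier quot" for C
      using that by (auto simp: carrier_quot \<tau>)
    show "\<tau> \<one>\<^bsub>quot\<^esub> = \<one>\<^bsub>B\<^esub>"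
      by (simp add: \<tau> flip: p.hom_one)
  qed
  then have "ring_hom_ring quot B \<tau>"
    by (rule ring_hom_ringI2[OF ring_quot h.S.ring_axioms])
  with \<tau> that show thesis by blast
qed

text \<open>
  The scalar product on the quotient is defined as a union over a coset. It is
  well-defined because multiplication by a scalar is multiplication by an element of
  the ring.
\<close>
lemma smult_quot:
  assumes smult: "\<And>x. x \<in> carrier A \<Longrightarrow> c \<odot>\<^bsub>A\<^esub> x = m \<otimes> x" and "m \<in> carrier A" "x \<in> carrier A"
  shows "c \<odot>\<^bsub>quot\<^esub> proj x = proj (m \<otimes> x)"
proof -
  interpret p: ring_hom_ring A quot proj by (rule hom_proj)
  have "proj (c \<odot>\<^bsub>A\<^esub> y) = proj (m \<otimes> x)" if "y \<in> proj x" for y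
  proof -
    have y: "y \<in> carrier A" using that I.a_elemrcos_carrier assms(3) by blast
    have "proj x = proj y" using that assms(3) by (rule I.a_repr_independence')
    with y assms show ?thesis by simp
  qed
  moreover have "x \<in> proj x" using assms(3) by (rule I.a_rcos_self)
  ultimately show ?thesis by (auto simp: quotient_algebra_simps)
qed

end

section \<open>Isomorphisms on representatives\<close>

text \<open>
  A surjective ring homomorphism \<open>\<pi>\<close> onto \<open>A\<close> through which scalars act by elements of
  the ring. It describes \<open>A\<close> by representatives, so that cosets of cosets need not be
  handled.
\<close>
definition algebra_cover ::
    "('k \<Rightarrow> 'r::ring_1) \<Rightarrow> ('k, 'a, 'm) module_scheme \<Rightarrow> ('r \<Rightarrow> 'a) \<Rightarrow> bool" where
  "algebra_cover s A \<pi> \<longleftrightarrow> ring A \<and> range \<pi> = carrier A \<and> \<pi> 1 = \<one>\<^bsub>A\<^esub> \<and>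
    (\<forall>p q. \<pi> (p + q) = \<pi> p \<oplus>\<^bsub>A\<^esub> \<pi> q) \<and> (\<forall>p q. \<pi> (p * q) = \<pi> p \<otimes>\<^bsub>A\<^esub> \<pi> q) \<and>
    (\<forall>c p. c \<odot>\<^bsub>A\<^esub> \<pi> p = \<pi> (s c * p))"

text \<open>
  Two quotients are isomorphic if there are maps in both directions between the rings
  above them which respect the kernels and are inverse to each other modulo the
  kernels.
\<close>
lemma algebra_iso_of_covers:
  assumes A: "algebra_cover s A \<pi>" and B: "algebra_cover s' B \<rho>"
    and \<theta>: "\<theta> 1 = 1" "\<And>p q. \<theta> (p + q) = \<theta> p + \<theta> q" "\<And>p q. \<theta> (p * q) = \<theta> p * \<theta> q"
      "\<And>c. \<theta> (s c) = s' c"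
    and ker: "\<And>p q. \<pi> p = \<pi> q \<Longrightarrow> \<rho> (\<theta> p) = \<rho> (\<theta> q)"
      "\<And>p q. \<rho> p = \<rho> q \<Longrightarrow> \<pi> (\<theta>' p) = \<pi> (\<theta>' q)"
    and inv: "\<And>p. \<pi> (\<theta>' (\<theta> p)) = \<pi> p" "\<And>q. \<rho> (\<theta> (\<theta>' q)) = \<rho> q"
  shows "\<exists>\<Phi> \<in> algebra_iso A B. \<forall>p. \<Phi> (\<pi> p) = \<rho> (\<theta> p)"
proof -
  define \<Phi> where "\<Phi> C = \<rho> (\<theta> (SOME p. \<pi> p = C))" for C
  \<comment> \<open>independent of the chosen representative, since \<open>\<theta>\<close> respects the kernels\<close>
  have \<Phi>: "\<Phi> (\<pi> p) = \<rho> (\<theta> p)" for p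
    unfolding \<Phi>_def by (rule ker(1), rule someI[where P = "\<lambda>q. \<pi> q = \<pi> p"], rule refl)
  have car: "carrier A = range \<pi>" "carrier B = range \<rho>"
    using A B by (auto simp: algebra_cover_def)
  have \<pi>: "\<one>\<^bsub>A\<^esub> = \<pi> 1" "\<pi> p \<oplus>\<^bsub>A\<^esub> \<pi> q = \<pi> (p + q)" "\<pi> p \<otimes>\<^bsub>A\<^esub> \<pi> q = \<pi> (p * q)"
      "c \<odot>\<^bsub>A\<^esub> \<pi> p = \<pi> (s c * p)" for c p q
    using A by (simp_all add: algebra_cover_def)
  have \<rho>: "\<one>\<^bsub>B\<^esub> = \<rho> 1" "\<rho> p \<oplus>\<^bsub>B\<^esub> \<rho> q = \<rho> (p + q)" "\<rho> p \<otimes>\<^bsub>B\<^esub> \<rho> q = \<rho> (p * q)"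
      "c \<odot>\<^bsub>B\<^esub> \<rho> p = \<rho> (s' c * p)" for c p q
    using B by (simp_all add: algebra_cover_def)
  have "\<Phi> \<in> ring_iso A B"
  proof (rule ring_iso_memI)
    have "inj_on \<Phi> (carrier A)"
    proof (rule inj_onI)
      fix C D assume "C \<in> carrier A" "D \<in> carrier A" and eq: "\<Phi> C = \<Phi> D"
      then obtain p q where C: "C = \<pi> p" and D: "D = \<pi> q" unfolding car by blast
      have "\<rho> (\<theta> p) = \<rho> (\<theta> q)" using eq by (simp add: C D \<Phi>)
      from ker(2)[OF this] show "C = D" by (simp add: C D inv)
    qed
    moreover have "\<Phi> ` carrier A = carrier B"
    proof -
      have "\<rho> q \<in> \<Phi> ` range \<pi>" for q
        by (rule image_eqI[of _ _ "\<pi> (\<theta>' q)"]) (simp_all add: \<Phi> inv)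
      then show ?thesis unfolding car by (auto simp: \<Phi>)
    qed
    ultimately show "bij_betw \<Phi> (carrier A) (carrier B)" by (simp add: bij_betw_def)
  qed (auto simp: car \<pi> \<rho> \<Phi> \<theta>)
  moreover have "\<Phi> (c \<odot>\<^bsub>A\<^esub> C) = c \<odot>\<^bsub>B\<^esub> \<Phi> C" if "C \<in> carrier A" for c C
    using that by (auto simp: car \<pi> \<rho> \<Phi> \<theta>)
  ultimately show ?thesis using \<Phi> by (auto simp: algebra_iso_def)
qed

section \<open>Maps between monoid algebras\<close>

text \<open>
  All maps between the monoid algebras below are given on monomials: \<open>g m c\<close> is the
  image of the monomial \<open>m\<close> with coefficient \<open>c\<close>.
\<close>
definition lin_ext :: "('m \<Rightarrow> 'c \<Rightarrow> 'r) \<Rightarrow> ('m \<Rightarrow>\<^sub>0 'c::zero) \<Rightarrow> 'r::comm_monoid_add" where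
  "lin_ext g p = (\<Sum>m\<in>Poly_Mapping.keys p. g m (Poly_Mapping.lookup p m))"

lemma poly_mapping_single_induct [case_names single add]:
  assumes "\<And>m c. P (Poly_Mapping.single m c)" "\<And>p q. P p \<Longrightarrow> P q \<Longrightarrow> P (p + q)"
  shows "P (p :: 'm \<Rightarrow>\<^sub>0 'c::comm_monoid_add)"
proof (induction p rule: update_induct)
  case const
  show ?case using assms(1)[of undefined 0] by simp
next
  case (update p m c)
  then have "Poly_Mapping.update m c p = p + Poly_Mapping.single m c"
    by (intro poly_mapping_eqI) (auto simp: lookup_update lookup_add lookup_single in_keys_iff when_def)
  with update assms show ?case by simp
qed

lemma lin_ext_single: "g m 0 = 0 \<Longrightarrow> lin_ext g (Poly_Mapping.single m c) = g m c"
  by (cases "c = 0") (auto simp: lin_ext_def)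

lemma lin_ext_add:
  assumes "\<And>m. g m 0 = 0" "\<And>m c d. g m (c + d) = g m c + g m d"
  shows "lin_ext g (p + q) = lin_ext g p + lin_ext g q"
  unfolding lin_ext_def by (rule setsum_keys_plus_distrib) (simp_all add: assms)

lemma lin_ext_mult:
  fixes g :: "'m::monoid_add \<Rightarrow> 'c::semiring_0 \<Rightarrow> 'r::semiring_0"
  assumes "\<And>m. g m 0 = 0" "\<And>m c d. g m (c + d) = g m c + g m d"
    and "\<And>m n c d. g (m + n) (c * d) = g m c * g n d"
  shows "lin_ext g (p * q) = lin_ext g p * lin_ext g q"
proof (induction p rule: poly_mapping_single_induct)
  case (single m c)
  show ?case
    by (induction q rule: poly_mapping_single_induct)
      (simp_all add: lin_ext_single lin_ext_add mult_single assms distrib_left)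
qed (simp add: lin_ext_add assms distrib_right)

section \<open>Algebras given by generators and relations\<close>

lemma relation_ideal_generators:
  "generated_quotient free_algebra {p - q | p q. (p, q) \<in> R}"
  by (intro generated_quotient.intro generated_quotient_axioms.intro ring_free_algebra) simp

lemma hom_free_algebra_diff:
  assumes "ring_hom_ring free_algebra B f" "f p = f q"
  shows "f (p - q) = \<zero>\<^bsub>B\<^esub>"
proof -
  interpret h: ring_hom_ring free_algebra B f by fact
  have "f \<in> ring_hom free_algebra B" and zero: "f 0 = \<zero>\<^bsub>B\<^esub>"
    using h.homh h.hom_zero by simp_all
  then have add: "f (x + y) = f x \<oplus>\<^bsub>B\<^esub> f y" for x y
    by (simp add: ring_hom_def)
  have "f (p + - q) = f (q + - q)" by (simp only: add assms(2))
  then show ?thesis by (simp add: zero)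
qed

context
  fixes R :: "(('k::comm_ring_1, 'g) free_alg \<times> ('k, 'g) free_alg) set"
begin

interpretation F: generated_quotient free_algebra "{p - q | p q. (p, q) \<in> R}"
  by (rule relation_ideal_generators)

lemma ring_presented_algebra: "ring (presented_algebra R)"
  unfolding presented_algebra_def relation_ideal_def by (rule F.ring_quot)

lemma hom_presented_algebra:
  "ring_hom_ring free_algebra (presented_algebra R) ((+>\<^bsub>free_algebra\<^esub>) (relation_ideal R))"
  unfolding presented_algebra_def relation_ideal_def by (rule F.hom_proj)

lemma carrier_presented_algebra:
  "carrier (presented_algebra R) = range ((+>\<^bsub>free_algebra\<^esub>) (relation_ideal R))"
  unfolding presented_algebra_def relation_ideal_def F.carrier_quot by simp

lemma smult_presented_algebra:
  "c \<odot>\<^bsub>presented_algebra R\<^esub> (relation_ideal R +>\<^bsub>free_algebra\<^esub> p) =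
   relation_ideal R +>\<^bsub>free_algebra\<^esub> (scalar c * p)"
  using F.smult_quot[of c "scalar c" p] by (simp add: presented_algebra_def relation_ideal_def)

lemma presented_algebra_relation:
  assumes "(p, q) \<in> R"
  shows "relation_ideal R +>\<^bsub>free_algebra\<^esub> p = relation_ideal R +>\<^bsub>free_algebra\<^esub> q"
proof -
  have "p - q \<in> relation_ideal R"
    unfolding relation_ideal_def using assms F.genideal_self[OF F.generators] by blast
  then have "p \<in> relation_ideal R +>\<^bsub>free_algebra\<^esub> q"
    by (force simp: a_r_coset_def')
  then show ?thesis
    unfolding relation_ideal_def using F.I.a_repr_independence'[of p q] by simp
qed

lemma presented_algebra_cover:
  "algebra_cover scalar (presented_algebra R) ((+>\<^bsub>free_algebra\<^esub>) (relation_ideal R))"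
proof -
  interpret h: ring_hom_ring free_algebra "presented_algebra R"
    "(+>\<^bsub>free_algebra\<^esub>) (relation_ideal R)"
    by (rule hom_presented_algebra)
  show ?thesis
    using h.hom_add h.hom_mult h.hom_one
    by (simp add: algebra_cover_def ring_presented_algebra carrier_presented_algebra
        smult_presented_algebra)
qed

text \<open>
  The universal property in the two forms used below: on representatives, and as a
  factorization to which the universal property of a further quotient can be applied.
\<close>
lemma presented_algebra_hom_eq:
  assumes f: "ring_hom_ring free_algebra B f" and eq: "\<And>p q. (p, q) \<in> R \<Longrightarrow> f p = f q"
  shows "\<And>p q. relation_ideal R +>\<^bsub>free_algebra\<^esub> p = relation_ideal R +>\<^bsub>free_algebra\<^esub> q \<Longrightarrow> f p = f q"
    and "\<exists>g. ring_hom_ring (presented_algebra R) B g \<and>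
      (\<forall>p. g (relation_ideal R +>\<^bsub>free_algebra\<^esub> p) = f p)"
proof -
  have "f (p - q) = \<zero>\<^bsub>B\<^esub>" if "(p, q) \<in> R" for p q
    using f eq[OF that] by (rule hom_free_algebra_diff)
  then have zero: "f s = \<zero>\<^bsub>B\<^esub>" if "s \<in> {p - q | p q. (p, q) \<in> R}" for s
    using that by blast
  show "f p = f q"
    if "relation_ideal R +>\<^bsub>free_algebra\<^esub> p = relation_ideal R +>\<^bsub>free_algebra\<^esub> q" for p q
    by (rule F.hom_eq_if_proj_eq[OF f], erule zero) (use that in \<open>simp_all add: relation_ideal_def\<close>)
  show "\<exists>g. ring_hom_ring (presented_algebra R) B g \<and>
      (\<forall>p. g (relation_ideal R +>\<^bsub>free_algebra\<^esub> p) = f p)"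
  proof -
    obtain g where "ring_hom_ring F.quot B g" "\<And>x. x \<in> carrier free_algebra \<Longrightarrow> g (F.proj x) = f x"
      by (rule F.induced_hom[OF f], erule zero, blast)
    then show ?thesis
      unfolding presented_algebra_def relation_ideal_def by auto
  qed
qed

end

lemma free_algebra_homI:
  assumes "algebra_cover s A \<pi>" "\<theta> 1 = 1" "\<And>p q. \<theta> (p + q) = \<theta> p + \<theta> q"
    "\<And>p q. \<theta> (p * q) = \<theta> p * \<theta> q"
  shows "ring_hom_ring free_algebra A (\<lambda>p. \<pi> (\<theta> p))"
  using assms
  by (intro ring_hom_ringI2 ring_free_algebra ring_hom_memI) (auto simp: algebra_cover_def)

section \<open>The specialized algebra\<close>

lemma ring_U_t: "ring U_t"
  unfolding U_t_def by (rule ring_presented_algebra)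

lemma generated_quotient_U_t: 
  "generated_quotient U_t {(tvar - 1) \<odot>\<^bsub>U_t\<^esub> \<one>\<^bsub>U_t\<^esub>}"
proof (intro generated_quotient.intro generated_quotient_axioms.intro ring_U_t)
  show "{(tvar - 1) \<odot>\<^bsub>U_t\<^esub> \<one>\<^bsub>U_t\<^esub>} \<subseteq> carrier U_t"
    using presented_algebra_cover[of U_rel] unfolding algebra_cover_def U_t_def[symmetric]
    by (metis empty_subsetI insert_subset rangeI)
qed

abbreviation U_t_class :: "(laurent, letter) free_alg \<Rightarrow> (laurent, letter) free_alg set" where
  "U_t_class p \<equiv> relation_ideal U_rel +>\<^bsub>free_algebra\<^esub> p"

abbreviation U_1_class :: "(laurent, letter) free_alg \<Rightarrow> (laurent, letter) free_alg set set" where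
  "U_1_class p \<equiv> t_minus_1_ideal +>\<^bsub>U_t\<^esub> U_t_class p"

lemma U_t_cover: "algebra_cover scalar U_t U_t_class"
  unfolding U_t_def by (rule presented_algebra_cover)

lemma U_t_smult: "c \<odot>\<^bsub>U_t\<^esub> U_t_class p = U_t_class (scalar c * p)"
  using U_t_cover by (simp add: algebra_cover_def)

lemma U_t_one: "\<one>\<^bsub>U_t\<^esub> = U_t_class 1"
  using U_t_cover by (simp add: algebra_cover_def)

lemma U_t_carrier: "carrier U_t = range U_t_class"
  using U_t_cover by (simp add: algebra_cover_def)

text \<open>
  Scalars act on \<open>\<U>(t)\<close> by multiplication with the class of a constant, so they
  also do after the second quotient, and the composition of both projections covers
  \<open>\<U>(1)\<close>.
\<close>
lemma U_1_cover: "algebra_cover (\<lambda>c. scalar (laurent_const c)) U_1 U_1_class"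
proof -
  interpret T: generated_quotient U_t "{(tvar - 1) \<odot>\<^bsub>U_t\<^esub> \<one>\<^bsub>U_t\<^esub>}"
    by (rule generated_quotient_U_t)
  interpret p: ring_hom_ring U_t T.quot T.proj by (rule T.hom_proj)
  have U_t: "U_t_class (p + q) = U_t_class p \<oplus>\<^bsub>U_t\<^esub> U_t_class q"
    "U_t_class (p * q) = U_t_class p \<otimes>\<^bsub>U_t\<^esub> U_t_class q" "U_t_class p \<in> carrier U_t" for p q
    using U_t_cover by (auto simp: algebra_cover_def)
  have smult: "c \<odot>\<^bsub>T.quot\<^esub> T.proj (U_t_class p) = T.proj (U_t_class (scalar c * p))" for c p
  proof -
    have "c \<odot>\<^bsub>U_t\<^esub> C = U_t_class (scalar c) \<otimes>\<^bsub>U_t\<^esub> C" if C: "C \<in> carrier U_t" for C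
    proof -
      from C obtain q where "C = U_t_class q" unfolding U_t_carrier by blast
      then show ?thesis by (simp only: U_t_smult U_t(2))
    qed
    from T.smult_quot[OF this U_t(3) U_t(3)] show ?thesis by (simp only: U_t(2))
  qed
  have range: "range (\<lambda>p. T.proj (U_t_class p)) = carrier T.quot"
    unfolding T.carrier_quot U_t_carrier by auto
  have one: "T.proj (U_t_class 1) = \<one>\<^bsub>T.quot\<^esub>"
    by (subst U_t_one[symmetric]) (rule p.hom_one)
  have add: "T.proj (U_t_class (p + q)) = T.proj (U_t_class p) \<oplus>\<^bsub>T.quot\<^esub> T.proj (U_t_class q)" for p q
    unfolding U_t(1) by (rule p.hom_add[OF U_t(3) U_t(3)])
  have mult: "T.proj (U_t_class (p * q)) = T.proj (U_t_class p) \<otimes>\<^bsub>T.quot\<^esub> T.proj (U_t_class q)" for p q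
    unfolding U_t(2) by (rule p.hom_mult[OF U_t(3) U_t(3)])
  show ?thesis
    unfolding algebra_cover_def U_1_def restrict_scalars_simps t_minus_1_ideal_def
    by (intro conjI allI; fact ring_restrict_scalars[OF T.ring_quot] range one add mult smult)
qed

text \<open>
  The universal property of \<open>\<U>(1)\<close>: a homomorphism from the free algebra factors
  first through \<open>\<U>(t)\<close>, because it satisfies the relations, and then through the
  specialization, because it identifies \<open>t\<close> with \<open>1\<close>.
\<close>
lemma U_1_hom_eq:
  assumes f: "ring_hom_ring free_algebra B f" and eq: "\<And>p q. (p, q) \<in> U_rel \<Longrightarrow> f p = f q"
    and t: "f (scalar tvar) = f 1"
    and "U_1_class p = U_1_class q"
  shows "f p = f q"
proof -
  interpret T: generated_quotient U_t "{(tvar - 1) \<odot>\<^bsub>U_t\<^esub> \<one>\<^bsub>U_t\<^esub>}"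
    by (rule generated_quotient_U_t)
  obtain g where g: "ring_hom_ring U_t B g" "\<And>p. g (U_t_class p) = f p"
    using presented_algebra_hom_eq(2)[OF f eq] unfolding U_t_def by blast
  have "f (scalar (tvar - 1)) = \<zero>\<^bsub>B\<^esub>"
    using hom_free_algebra_diff[OF f t] by (simp add: scalar_def single_diff)
  then have "g s = \<zero>\<^bsub>B\<^esub>" if "s \<in> {(tvar - 1) \<odot>\<^bsub>U_t\<^esub> \<one>\<^bsub>U_t\<^esub>}" for s
    using that by (simp add: U_t_one U_t_smult g)
  from T.hom_eq_if_proj_eq[OF g(1) this, of "U_t_class p" "U_t_class q"] assms(4)
  show ?thesis by (simp add: g(2) U_t_carrier t_minus_1_ideal_def)
qed

lemma U_1_relation: "(p, q) \<in> U_rel \<Longrightarrow> U_1_class p = U_1_class q"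
  by (simp only: presented_algebra_relation)

lemma U_1_tvar: "U_1_class (scalar tvar) = U_1_class 1"
proof -
  interpret T: generated_quotient U_t "{(tvar - 1) \<odot>\<^bsub>U_t\<^esub> \<one>\<^bsub>U_t\<^esub>}"
    by (rule generated_quotient_U_t)
  let ?s = "(tvar - 1) \<odot>\<^bsub>U_t\<^esub> \<one>\<^bsub>U_t\<^esub>"
  have "?s \<in> t_minus_1_ideal"
    unfolding t_minus_1_ideal_def using T.genideal_self[OF T.generators] by simp
  moreover have "U_t_class (scalar tvar) = ?s \<oplus>\<^bsub>U_t\<^esub> U_t_class 1"
  proof -
    have "scalar tvar = scalar (tvar - 1) + (1 :: (laurent, letter) free_alg)"
      by (simp add: scalar_def single_diff)
    then show ?thesis
      using U_t_cover by (simp add: U_t_one U_t_smult algebra_cover_def)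
  qed
  ultimately have "U_t_class (scalar tvar) \<in> t_minus_1_ideal +>\<^bsub>U_t\<^esub> U_t_class 1"
    unfolding a_r_coset_def' by blast
  moreover have "U_t_class 1 \<in> carrier U_t" using U_t_carrier by blast
  ultimately show ?thesis
    unfolding t_minus_1_ideal_def using T.I.a_repr_independence'[of "U_t_class (scalar tvar)" "U_t_class 1"]
    by simp
qed

section \<open>The isomorphism\<close>

abbreviation W_class :: "(rat, letter list) free_alg \<Rightarrow> (rat, letter list) free_alg set" where
  "W_class p \<equiv> relation_ideal W_rel +>\<^bsub>free_algebra\<^esub> p"

abbreviation monomial :: "'g list \<Rightarrow> ('k::comm_ring_1, 'g) free_alg" where
  "monomial w \<equiv> Poly_Mapping.single (Mon w) 1"

lemma monomial_mult: "monomial v * monomial w = monomial (v @ w)"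
  by (simp add: mult_single plus_free_monoid_def)

lemma monomial_Nil: "monomial [] = 1"
  by (simp flip: zero_free_monoid_def)

lemma single_eq_scalar_monomial: "Poly_Mapping.single (Mon w) c = scalar c * monomial w"
  by (simp add: scalar_def mult_single)

lemma W_cover: "algebra_cover scalar W_alg W_class"
  unfolding W_alg_def by (rule presented_algebra_cover)

lemma W_class_simps:
  "W_class (p + q) = W_class p \<oplus>\<^bsub>W_alg\<^esub> W_class q"
  "W_class (p * q) = W_class p \<otimes>\<^bsub>W_alg\<^esub> W_class q"
  using W_cover by (simp_all add: algebra_cover_def)

lemma U_1_class_simps:
  "U_1_class (p + q) = U_1_class p \<oplus>\<^bsub>U_1\<^esub> U_1_class q"
  "U_1_class (p * q) = U_1_class p \<otimes>\<^bsub>U_1\<^esub> U_1_class q"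
  using U_1_cover by (simp_all add: algebra_cover_def)

lemma W_relation: "(p, q) \<in> W_rel \<Longrightarrow> W_class p = W_class q"
  by (rule presented_algebra_relation)

lemma W_class_letters: "W_class (monomial (map (\<lambda>a. [a]) w)) = W_class (gen w)"
proof (induction w)
  case Nil
  show ?case using W_relation[OF W_rel.intros(3)] by (simp add: monomial_Nil)
next
  case (Cons a w)
  have "W_class (monomial (map (\<lambda>a. [a]) (a # w))) = W_class (gen [a] * monomial (map (\<lambda>a. [a]) w))"
    by (simp add: gen_def monomial_mult)
  also have "\<dots> = W_class (gen [a] * gen w)"
    by (simp only: W_class_simps Cons.IH)
  also have "\<dots> = W_class (gen (a # w))"
    using W_relation[OF W_rel.intros(1), of "[a]" w] by simp
  finally show ?case .
qed

lemma W_class_concat: "W_class (monomial ws) = W_class (gen (concat ws))"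
proof (induction ws)
  case Nil
  show ?case using W_relation[OF W_rel.intros(3)] by (simp add: monomial_Nil)
next
  case (Cons w ws)
  have "W_class (monomial (w # ws)) = W_class (gen w * monomial ws)"
    by (simp add: gen_def monomial_mult)
  also have "\<dots> = W_class (gen w * gen (concat ws))"
    by (simp only: W_class_simps Cons.IH)
  also have "\<dots> = W_class (gen (concat (w # ws)))"
    using W_relation[OF W_rel.intros(1), of w "concat ws"] by simp
  finally show ?case .
qed

text \<open>The sum of the coefficients of a Laurent polynomial is its value at \<open>t = 1\<close>.\<close>
definition eval_1 :: "laurent \<Rightarrow> rat" where
  "eval_1 = lin_ext (\<lambda>_ c. c)"

text \<open>
  The isomorphism and its inverse on representatives. They are inverse to each other
  only modulo the relations, since \<open>to_words\<close> forgets \<open>t\<close> and \<open>to_letters\<close> forgets how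
  a product is divided into words.
\<close>
definition to_words :: "(laurent, letter) free_alg \<Rightarrow> (rat, letter list) free_alg" where
  "to_words = lin_ext (\<lambda>m c. Poly_Mapping.single (Mon (map (\<lambda>a. [a]) (mon_list m))) (eval_1 c))"

definition to_letters :: "(rat, letter list) free_alg \<Rightarrow> (laurent, letter) free_alg" where
  "to_letters = lin_ext (\<lambda>m c. Poly_Mapping.single (Mon (concat (mon_list m))) (laurent_const c))"

lemma eval_1_single: "eval_1 (Poly_Mapping.single n c) = c"
  unfolding eval_1_def by (rule lin_ext_single) simp

lemma eval_1_add: "eval_1 (c + d) = eval_1 c + eval_1 d"
  unfolding eval_1_def by (rule lin_ext_add) simp_all

lemma eval_1_mult: "eval_1 (c * d) = eval_1 c * eval_1 d"
  unfolding eval_1_def by (rule lin_ext_mult) simp_all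

lemmas eval_1_simps = eval_1_single eval_1_add eval_1_mult

lemma eval_1_0: "eval_1 0 = 0" and eval_1_1: "eval_1 1 = 1"
  using eval_1_single[of 0 0] eval_1_single[of 0 1] by simp_all

lemma laurent_const_simps:
  "laurent_const 0 = 0" "laurent_const 1 = 1"
  "laurent_const (c + d) = laurent_const c + laurent_const d"
  "laurent_const (c * d) = laurent_const c * laurent_const d"
  by (simp_all add: laurent_const_def single_add mult_single)

lemma to_words_single:
  "to_words (Poly_Mapping.single (Mon w) c) = Poly_Mapping.single (Mon (map (\<lambda>a. [a]) w)) (eval_1 c)"
  unfolding to_words_def by (subst lin_ext_single) (simp_all add: eval_1_0)

lemma to_words_add: "to_words (p + q) = to_words p + to_words q"
  unfolding to_words_def by (rule lin_ext_add) (simp_all add: eval_1_0 eval_1_simps single_add)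

lemma to_words_mult: "to_words (p * q) = to_words p * to_words q"
  unfolding to_words_def
  by (rule lin_ext_mult)
    (simp_all add: eval_1_0 eval_1_simps single_add mult_single plus_free_monoid_def)

lemma to_words_scalar: "to_words (scalar c) = scalar (eval_1 c)"
  using to_words_single[of "[]" c] by (simp add: scalar_def zero_free_monoid_def)

lemma scalar_1: "scalar 1 = 1"
  by (simp add: scalar_def)

lemma to_words_1: "to_words 1 = 1"
  using to_words_scalar[of 1] by (simp add: scalar_1 eval_1_1)

lemma to_words_gen: "to_words (gen a) = gen [a]"
  by (simp add: gen_def to_words_single eval_1_1)

lemma to_words_monomial: "to_words (monomial w) = monomial (map (\<lambda>a. [a]) w)"
  by (simp add: to_words_single eval_1_1)

lemma to_letters_single:
  "to_letters (Poly_Mapping.single (Mon ws) c) = Poly_Mapping.single (Mon (concat ws)) (laurent_const c)"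
  unfolding to_letters_def by (subst lin_ext_single) (simp_all add: laurent_const_simps)

lemma to_letters_add: "to_letters (p + q) = to_letters p + to_letters q"
  unfolding to_letters_def by (rule lin_ext_add) (simp_all add: laurent_const_simps single_add)

lemma to_letters_mult: "to_letters (p * q) = to_letters p * to_letters q"
  unfolding to_letters_def
  by (rule lin_ext_mult)
    (simp_all add: laurent_const_simps single_add mult_single plus_free_monoid_def)

lemma to_letters_1: "to_letters 1 = 1"
  using to_letters_single[of "[]" 1] by (simp add: laurent_const_simps monomial_Nil)

lemma to_letters_gen: "to_letters (gen w) = monomial w"
  by (simp add: gen_def to_letters_single laurent_const_simps)

lemma basic_move_class:
  "basic_move v w \<Longrightarrow> W_class (gen v) = W_class (gen w)"
  by (intro W_relation W_rel.intros word_equiv_basic_move)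

text \<open>
  The relations of \<open>\<U>(1)\<close> hold for words because the two sides of a move
  are crystal equivalent.
\<close>
lemma W_class_U_rel:
  assumes "(p, q) \<in> U_rel"
  shows "W_class (to_words p) = W_class (to_words q)"
proof -
  have letters: "W_class (monomial (map (\<lambda>a. [a]) v)) = W_class (monomial (map (\<lambda>a. [a]) w))"
    if "basic_move v w" for v w
    using basic_move_class[OF that] by (simp only: W_class_letters)
  show ?thesis
    using assms
  proof cases
    case (1 j i k)
    then show ?thesis using letters[OF basic_move.intros(1)]
      by (simp add: to_words_monomial gen_def monomial_mult)
  next
    case (2 j i k)
    then show ?thesis using letters[OF basic_move.intros(2)]
      by (simp add: to_words_monomial gen_def monomial_mult)
  next
    case (3 j k i)
    then show ?thesis using letters[OF basic_move.intros(3)]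
      by (simp add: to_words_monomial gen_def monomial_mult)
  next
    case (4 j k i)
    then show ?thesis using letters[OF basic_move.intros(4)]
      by (simp add: to_words_monomial gen_def monomial_mult)
  next
    case (5 i)
    then show ?thesis using letters[OF basic_move.intros(5)]
      by (simp add: to_words_monomial gen_def monomial_mult)
  next
    case 6
    then show ?thesis using letters[OF basic_move.intros(6)]
      by (simp add: to_words_monomial gen_def monomial_mult monomial_Nil to_words_scalar
          tvar_def eval_1_simps scalar_1)
  next
    case (7 i j)
    then show ?thesis using letters[OF basic_move.intros(7)]
      by (simp add: to_words_monomial gen_def monomial_mult)
  qed
qed

lemma U_1_class_basic_move:
  assumes "basic_move v w"
  shows "U_1_class (monomial v) = U_1_class (monomial w)"
  using assms
proof cases
  case 6
  then show ?thesis
    using U_1_relation[OF U_rel.intros(6)] U_1_tvar by (simp add: gen_def monomial_mult monomial_Nil)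
qed (use U_1_relation[OF U_rel.intros(1)] U_1_relation[OF U_rel.intros(2)]
    U_1_relation[OF U_rel.intros(3)] U_1_relation[OF U_rel.intros(4)]
    U_1_relation[OF U_rel.intros(5)] U_1_relation[OF U_rel.intros(7)]
    in \<open>simp_all add: gen_def monomial_mult\<close>)

lemma U_1_class_word_cong: "v \<sim> w \<Longrightarrow> U_1_class (monomial v) = U_1_class (monomial w)"
proof (induction rule: word_cong.induct)
  case (move v w p q)
  have "U_1_class (monomial p * monomial v * monomial q) = U_1_class (monomial p * monomial w * monomial q)"
    by (simp only: U_1_class_simps U_1_class_basic_move[OF move])
  then show ?case by (simp add: monomial_mult)
qed auto

text \<open>
  Conversely, crystal equivalent words have to become equal in \<open>\<U>(1)\<close>.
\<close>
lemma U_1_class_W_rel: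
  assumes "(p, q) \<in> W_rel"
  shows "U_1_class (to_letters p) = U_1_class (to_letters q)"
  using assms
proof cases
  case (2 v w)
  then show ?thesis
    using U_1_class_word_cong[OF word_cong_if_word_equiv] by (simp add: to_letters_gen)
qed (simp_all add: to_letters_mult to_letters_gen to_letters_1 monomial_mult monomial_Nil)

lemma scalar_simps:
  "scalar (c + d) = scalar c + scalar d" "scalar (c * d) = scalar c * scalar d"
  by (simp_all add: scalar_def single_add mult_single)

text \<open>
  The induction has to go in both directions: \<open>t\<close> is invertible, and negative powers
  become \<open>1\<close> because multiplying them by \<open>t\<close> does not change their class.
\<close>
lemma U_1_class_t_power: "U_1_class (scalar (Poly_Mapping.single n 1)) = U_1_class 1"
proof -
  have step: "U_1_class (scalar (Poly_Mapping.single (n + 1) 1)) =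
      U_1_class (scalar (Poly_Mapping.single n 1))" for n
  proof -
    have "Poly_Mapping.single (n + 1) 1 = Poly_Mapping.single n 1 * tvar"
      by (simp add: tvar_def mult_single)
    then have "U_1_class (scalar (Poly_Mapping.single (n + 1) 1)) =
        U_1_class (scalar (Poly_Mapping.single n 1) * 1)"
      by (simp only: scalar_simps U_1_class_simps U_1_tvar)
    then show ?thesis by simp
  qed
  show ?thesis
  proof (induction n rule: int_induct[of _ 0])
    case base
    show ?case by (simp add: scalar_1)
  next
    case (step1 i)
    then show ?case by (simp only: step)
  next
    case (step2 i)
    then show ?case using step[of "i - 1"] by simp
  qed
qed

lemma U_1_class_scalar: "U_1_class (scalar c) = U_1_class (scalar (laurent_const (eval_1 c)))"
proof (induction c rule: poly_mapping_single_induct)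
  case (single n r)
  have "Poly_Mapping.single n r = laurent_const r * Poly_Mapping.single n 1"
    by (simp add: laurent_const_def mult_single)
  then have "U_1_class (scalar (Poly_Mapping.single n r)) = U_1_class (scalar (laurent_const r) * 1)"
    by (simp only: scalar_simps U_1_class_simps U_1_class_t_power)
  then show ?case by (simp add: eval_1_simps)
next
  case (add c d)
  then show ?case by (simp only: scalar_simps eval_1_simps laurent_const_simps U_1_class_simps)
qed

lemma concat_singletons: "concat (map (\<lambda>a. [a]) w) = w"
  by simp

lemma U_1_class_to_letters_to_words: "U_1_class (to_letters (to_words p)) = U_1_class p"
proof (induction p rule: poly_mapping_single_induct)
  case (single m c)
  obtain w where m: "m = Mon w" by (cases m)
  have "U_1_class (to_letters (to_words (Poly_Mapping.single m c))) =
      U_1_class (scalar (laurent_const (eval_1 c)) * monomial w)"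
    unfolding m to_words_single to_letters_single concat_singletons
    by (simp only: single_eq_scalar_monomial[of w "laurent_const (eval_1 c)"])
  also have "\<dots> = U_1_class (scalar c * monomial w)"
    by (simp only: U_1_class_simps U_1_class_scalar[of c])
  finally show ?case by (simp add: m single_eq_scalar_monomial[of w c])
next
  case (add p q)
  then show ?case by (simp only: to_words_add to_letters_add U_1_class_simps)
qed

lemma W_class_to_words_to_letters: "W_class (to_words (to_letters q)) = W_class q"
proof (induction q rule: poly_mapping_single_induct)
  case (single m c)
  obtain ws where m: "m = Mon ws" by (cases m)
  have "W_class (to_words (to_letters (Poly_Mapping.single m c))) =
      W_class (scalar c * monomial (map (\<lambda>a. [a]) (concat ws)))"
    unfolding m to_words_single to_letters_single laurent_const_def eval_1_simps
    by (simp only: single_eq_scalar_monomial[of _ c])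
  also have "\<dots> = W_class (scalar c * monomial ws)"
    by (simp only: W_class_simps W_class_concat concat_singletons)
  finally show ?case by (simp add: m single_eq_scalar_monomial[of ws c])
next
  case (add p q)
  then show ?case by (simp only: to_words_add to_letters_add W_class_simps)
qed

theorem theorem4p7:
  shows "\<exists>\<Phi> \<in> algebra_iso U_1 W_alg. \<forall>a :: letter. \<Phi> (U_1_gen a) = W_sym [a]"
proof -
  have "\<exists>\<Phi> \<in> algebra_iso U_1 W_alg. \<forall>p. \<Phi> (U_1_class p) = W_class (to_words p)"
  proof (rule algebra_iso_of_covers[OF U_1_cover W_cover])
    show "W_class (to_words p) = W_class (to_words q)" if "U_1_class p = U_1_class q" for p q
    proof (rule U_1_hom_eq[OF _ _ _ that])
      show "ring_hom_ring free_algebra W_alg (\<lambda>p. W_class (to_words p))"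
        by (rule free_algebra_homI[OF W_cover to_words_1 to_words_add to_words_mult])
      show "W_class (to_words (scalar tvar)) = W_class (to_words 1)"
        by (simp add: to_words_scalar to_words_1 tvar_def eval_1_simps scalar_1)
    qed (rule W_class_U_rel)
    show "U_1_class (to_letters p) = U_1_class (to_letters q)" if "W_class p = W_class q" for p q
    proof (rule presented_algebra_hom_eq(1)[OF _ _ that])
      show "ring_hom_ring free_algebra U_1 (\<lambda>p. U_1_class (to_letters p))"
        by (rule free_algebra_homI[OF U_1_cover to_letters_1 to_letters_add to_letters_mult])
    qed (rule U_1_class_W_rel)
    show "to_words (scalar (laurent_const c)) = scalar c" for c
      by (simp add: to_words_scalar laurent_const_def eval_1_simps)
  qed (fact to_words_1 to_words_add to_words_mult U_1_class_to_letters_to_words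
      W_class_to_words_to_letters)+
  then show ?thesis
    unfolding U_1_gen_def W_sym_def presented_gen_def by (metis to_words_gen)
qed

end
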